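(* Let $I\subset\mathbb{R}$ be a compact interval. There is a constant $C_I>0$, depending only on $I$, such that for all real $Q\ge2$ and $0<\delta<1/2$, $$ N_{g,\mathcal V_3}(Q,\delta)\le C_I\, Q^2\delta^2 . $$
   Context: For coprime $(u,v)\in\mathbb{Z}^2$, let $L_{P_{u,v}}\subset\mathbb{R}^4$ be the two-dimensional linear subspace attached to the polynomial $P_{u,v}(x)=(vx-u)^2$, namely the set of $(x_0,x_1,x_2,x_3)$ with $$u^2x_0-2uvx_1+v^2x_2=0,\qquad u^2x_1-2uvx_2+v^2x_3=0.$$ A point $\mathbf p=(p_0,p_1,p_2,p_3)\in\mathbb{Z}^4$ is called special if $\mathbf p\in L_{P_{u,v}}$ for some coprime $(u,v)\in\mathbb{Z}^2$; all other points of $\mathbb{Z}^4$ are called generic. For a compact interval $I$, write $\mathcal V_3=\{(\xi,\xi^2,\xi^3):\xi\in I\}$, and let $N_{g,\mathcal V_3}(Q,\delta)$ be the number of generic $\mathbf p\in\mathbb{Z}^4$ with $1\le p_0\le Q$ and $$\inf_{\mathbf x\in\mathcal V_3}\ \max_{1\le i\le3}|p_0x_i-p_i|\le\delta .$$ *)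

theory Defs
  imports "HOL-Analysis.Analysis"
begin

text \<open>The plane attached to the polynomial \<open>P(x) = (v x - u)\<^sup>2 = u\<^sup>2 - 2 u v x + v\<^sup>2 x\<^sup>2\<close>:
  the two equations are the coefficients of \<open>P\<close> applied to \<open>(x0, x1, x2)\<close> and \<open>(x1, x2, x3)\<close>.\<close>

definition L_plane :: "int \<Rightarrow> int \<Rightarrow> (real \<times> real \<times> real \<times> real) set" where
  "L_plane u v = {(x0, x1, x2, x3).
     (of_int u)\<^sup>2 * x0 - 2 * of_int u * of_int v * x1 + (of_int v)\<^sup>2 * x2 = 0 \<and>
     (of_int u)\<^sup>2 * x1 - 2 * of_int u * of_int v * x2 + (of_int v)\<^sup>2 * x3 = 0}"

definition special :: "int \<times> int \<times> int \<times> int \<Rightarrow> bool" where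
  "special = (\<lambda>(p0, p1, p2, p3). \<exists>u v. coprime u v \<and>
     (of_int p0, of_int p1, of_int p2, of_int p3) \<in> L_plane u v)"

abbreviation generic :: "int \<times> int \<times> int \<times> int \<Rightarrow> bool" where
  "generic p \<equiv> \<not> special p"

definition veronese3 :: "real set \<Rightarrow> (real \<times> real \<times> real) set" where
  "veronese3 I = (\<lambda>\<xi>. (\<xi>, \<xi>\<^sup>2, \<xi>^3)) ` I"

text \<open>The infimum below is meaningful only for nonempty \<open>I\<close>.\<close>

definition generic_points :: "real set \<Rightarrow> real \<Rightarrow> real \<Rightarrow> (int \<times> int \<times> int \<times> int) set" where
  "generic_points I Q \<delta> = {(p0, p1, p2, p3).
     generic (p0, p1, p2, p3) \<and> 1 \<le> p0 \<and> of_int p0 \<le> Q \<and>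
     (INF (x1, x2, x3) \<in> veronese3 I.
        Max {\<bar>of_int p0 * x1 - of_int p1\<bar>, \<bar>of_int p0 * x2 - of_int p2\<bar>,
             \<bar>of_int p0 * x3 - of_int p3\<bar>}) \<le> \<delta>}"

text \<open>\<open>card\<close> is 0 on infinite sets, so a bound on \<open>N_g\<close> carries information only together
  with finiteness of \<open>generic_points I Q \<delta>\<close>.\<close>

definition N_g :: "real set \<Rightarrow> real \<Rightarrow> real \<Rightarrow> nat" where
  "N_g I Q \<delta> = card (generic_points I Q \<delta>)"

end

theory Submission
  imports Defs
begin

text \<open>
  Identify \<open>p\<close> with the binary cubic form
  \<open>p0 X\<^sup>3 + 3 p1 X\<^sup>2 Y + 3 p2 X Y\<^sup>2 + p3 Y\<^sup>3\<close>, on which \<open>SL\<^sub>2(\<int>)\<close> acts. A point whose form has a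
  repeated root (\<open>discr p = 0\<close>) is special (\<open>special_if_discr_zero\<close>), so generic points give forms
  without repeated roots. The equations of the curve are best read after completing the cube: with
  \<open>\<xi> = p1 / p0\<close>, \<open>u = X + \<xi> Y\<close>, \<open>v = Y\<close> the form becomes \<open>p0 u\<^sup>3 + 3 e2 u v\<^sup>2 + e3 v\<^sup>3\<close>, and if
  \<open>p\<close> lies within \<open>\<delta>\<close> of the cone over the curve, then \<open>\<xi>\<close> is bounded and \<open>e2\<close>, \<open>e3\<close> are
  \<open>O(\<delta>)\<close> (\<open>near_curve_depressed\<close>). The discriminant is then \<open>O((Q \<delta>)\<^sup>2)\<close>, and
  by Davenport the number of classes of integral cubic forms with nonzero discriminant at most \<open>X\<close>
  is \<open>O(X)\<close>. This suggests the bound \<open>Q\<^sup>2 \<delta>\<^sup>2\<close>; the issue is that one class can meet the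
  neighbourhood of the curve many times, but classes that do so have small discriminant.

  Both facts are proved together, with the points sorted by \<open>p0\<close> of size \<open>Q\<close> and by
  \<open>e3\<close> of size \<open>\<eta> \<delta>\<close>, where \<open>Q\<close> and \<open>\<eta>\<close> are halved repeatedly.

  Counting forms (\<open>orbit_count\<close>). Rescaling \<open>u\<close> and \<open>v\<close> by \<open>t\<close> and \<open>1 / t\<close> with
  \<open>t\<^sup>6 = Q / (\<eta> \<delta>)\<close> makes all coefficients \<open>O(S)\<close>, \<open>S\<^sup>2 = Q \<eta> \<delta>\<close>. The rescaled coordinates
  define a lattice of covolume 1; a reduced basis with first vector of length about \<open>2\<^sup>-\<^sup>j\<close> turns \<open>p\<close>
  into an integral form with coefficients \<open>O(S 8\<^sup>-\<^sup>j)\<close>, \<open>O(S 2\<^sup>-\<^sup>j)\<close>, \<open>O(S 2\<^sup>j)\<close>, \<open>O(S 8\<^sup>j)\<close>. Adding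
  multiples \<open>k < 4\<^sup>j\<close> of the short vector to the long one stays in this box, so each point accounts
  for \<open>4\<^sup>j\<close> forms in it. This gain makes the sum over \<open>j\<close> converge: no logarithm is lost in
  the cusp, and forms with vanishing leading coefficient are harmless. The result is
  \<open>O(S\<^sup>4) = O((Q \<eta> \<delta>)\<^sup>2)\<close> times the largest number \<open>m\<close> of points counted with one form.

  Counting within an orbit. A point of the orbit of \<open>p\<close> is determined, up to boundedly many
  choices, by the first row \<open>r\<close> of the matrix moving \<open>p\<close> there (\<open>orbit_fibre_card\<close>). If
  \<open>\<eta>\<^sup>2\<close> is larger than \<open>\<delta> / Q\<close> by a constant factor, the Hessian of \<open>p\<close> splits into two real linear
  forms \<open>U\<close>, \<open>V\<close> in which \<open>p\<close> is a combination of \<open>U\<^sup>3\<close> and \<open>V\<^sup>3\<close>; smallness of the Hessian and the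
  size of the form at \<open>r\<close> put \<open>r\<close> into two parallelograms of area \<open>O(1 / \<eta>)\<close>, so \<open>m = O(1 / \<eta>)\<close>
  and these points number \<open>O(Q\<^sup>2 \<delta>\<^sup>2 \<eta>)\<close> (\<open>region_count_top\<close>), a convergent sum over \<open>\<eta> = 2\<^sup>-\<^sup>i\<close>.
  Once \<open>\<eta>\<^sup>2\<close> is of order \<open>\<delta> / Q\<close> the halving stops: there the trivial count of all rows
  compatible with the reduced bases gives \<open>m = O(t\<^sup>2) = O(1 / \<eta>)\<close>, which is just enough
  (\<open>region_count_balanced\<close>).
\<close>

section \<open>Binary cubic forms and the action of integral matrices\<close>

type_synonym cubic = "int \<times> int \<times> int \<times> int"

text \<open>The symmetric trilinear form whose diagonal is the cubic form with binomial coefficients.\<close>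

definition polar :: "cubic \<Rightarrow> int \<times> int \<Rightarrow> int \<times> int \<Rightarrow> int \<times> int \<Rightarrow> int" where
  "polar = (\<lambda>(p0, p1, p2, p3) (x, x') (y, y') (z, z').
     p0 * x * y * z + p1 * (x * y * z' + x * y' * z + x' * y * z)
     + p2 * (x * y' * z' + x' * y * z' + x' * y' * z) + p3 * x' * y' * z')"

text \<open>Substitution of the basis \<open>r\<close>, \<open>s\<close>. The two rows are separate arguments because the first row
  alone determines the new form up to translation.\<close>

definition act :: "int \<times> int \<Rightarrow> int \<times> int \<Rightarrow> cubic \<Rightarrow> cubic" where
  "act r s p = (polar p r r r, polar p r r s, polar p r s s, polar p s s s)"

definition det2 :: "int \<times> int \<Rightarrow> int \<times> int \<Rightarrow> int" where
  "det2 r s = fst r * snd s - snd r * fst s"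

definition row_add :: "int \<times> int \<Rightarrow> int \<Rightarrow> int \<times> int \<Rightarrow> int \<times> int" where
  "row_add s m r = (fst s + m * fst r, snd s + m * snd r)"

text \<open>The discriminant of the Hessian \<open>hess p\<close>, which is a constant multiple of the discriminant of
  the cubic form.\<close>

definition discr :: "cubic \<Rightarrow> int" where
  "discr = (\<lambda>(p0, p1, p2, p3).
     (p0 * p3 - p1 * p2)\<^sup>2 - 4 * (p1 * p3 - p2\<^sup>2) * (p0 * p2 - p1\<^sup>2))"

definition hess :: "cubic \<Rightarrow> int \<times> int \<Rightarrow> int" where
  "hess = (\<lambda>(p0, p1, p2, p3) (x, y).
     (p0 * p2 - p1\<^sup>2) * x\<^sup>2 + (p0 * p3 - p1 * p2) * x * y + (p1 * p3 - p2\<^sup>2) * y\<^sup>2)"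

lemma polar_row_comb:
  "polar (act r s p) (x, x') (y, y') (z, z') =
   polar p (x * fst r + x' * fst s, x * snd r + x' * snd s)
     (y * fst r + y' * fst s, y * snd r + y' * snd s)
     (z * fst r + z' * fst s, z * snd r + z' * snd s)"
  by (cases p; cases r; cases s) (simp add: act_def polar_def algebra_simps)

lemma act_act:
  "act (x, x') (y, y') (act r s p) =
   act (x * fst r + x' * fst s, x * snd r + x' * snd s)
       (y * fst r + y' * fst s, y * snd r + y' * snd s) p"
  unfolding act_def[of "(x, x')" "(y, y')"] polar_row_comb by (simp add: act_def)

lemma act_id: "act (1, 0) (0, 1) p = p"
  by (cases p) (simp add: act_def polar_def)

lemma act_inverse:
  assumes "det2 r s = 1"
  shows "act (snd s, - snd r) (- fst s, fst r) (act r s p) = p"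
proof -
  have "act (snd s, - snd r) (- fst s, fst r) (act r s p) = act (1, 0) (0, 1) p"
    unfolding act_act using assms
    by (intro arg_cong3[where f = act]) (auto simp: det2_def algebra_simps)
  then show ?thesis by (simp add: act_id)
qed

text \<open>Adding a multiple of the first row to the second is a translation: it fixes the leading
  coefficient and moves the second one by multiples of it. Both the recovery of a point from its
  first row and the \<open>4\<^sup>j\<close> translates in the cusp rest on these formulas.\<close>

lemma act_row_add:
  assumes "act r s p = (f0, f1, f2, f3)"
  shows "act r (row_add s m r) p =
    (f0, f1 + m * f0, f2 + 2 * m * f1 + m\<^sup>2 * f0, f3 + 3 * m * f2 + 3 * m\<^sup>2 * f1 + m ^ 3 * f0)"
proof -
  have "act r (row_add s m r) p = act (1, 0) (m, 1) (act r s p)"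
    unfolding act_act by (simp add: row_add_def algebra_simps)
  then show ?thesis
    unfolding assms by (simp add: act_def polar_def power2_eq_square power3_eq_cube algebra_simps)
qed

lemma det2_row_add: "det2 r (row_add s m r) = det2 r s"
  by (simp add: det2_def row_add_def algebra_simps)

text \<open>The Hessian is a covariant: its value at \<open>r\<close> is its leading coefficient in a basis starting
  with \<open>r\<close>.\<close>

lemma hess_act:
  assumes "act r s p = (f0, f1, f2, f3)"
  shows "f0 * f2 - f1\<^sup>2 = (det2 r s)\<^sup>2 * hess p r"
proof -
  obtain p0 p1 p2 p3 where [simp]: "p = (p0, p1, p2, p3)" by (cases p)
  obtain x y where [simp]: "r = (x, y)" by (cases r)
  obtain z w where [simp]: "s = (z, w)" by (cases s)
  have "f0 = polar p r r r" "f1 = polar p r r s" "f2 = polar p r s s"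
    using assms by (simp_all add: act_def)
  then show ?thesis
    by (simp add: polar_def hess_def det2_def power2_eq_square algebra_simps)
qed

text \<open>A form \<open>3 f2 X Y\<^sup>2 + f3 Y\<^sup>3\<close> has a double root in every basis; hence the first two coefficients
  of a transform of a form with nonzero discriminant cannot both vanish.\<close>

lemma discr_act_double_root: "discr (act r s (0, 0, f2, f3)) = 0"
proof -
  obtain x y where [simp]: "r = (x, y)" by (cases r)
  obtain z w where [simp]: "s = (z, w)" by (cases s)
  show ?thesis
    by (simp add: act_def polar_def discr_def power2_eq_square algebra_simps)
qed

lemma det2_same_row:
  assumes "det2 r s = 1" "det2 r s' = 1"
  obtains m where "s' = row_add s m r"
proof -
  obtain x y where r: "r = (x, y)" by (cases r)
  obtain z w where s: "s = (z, w)" by (cases s)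
  obtain z' w' where s': "s' = (z', w')" by (cases s')
  define m where "m = z' * w - w' * z"
  have 1: "x * w - y * z = 1" "x * w' - y * z' = 1" using assms by (auto simp: r s s' det2_def)
  have "z' = z + m * x" "w' = w + m * y" unfolding m_def using 1 by algebra+
  then have "s' = row_add s m r" by (simp add: r s s' row_add_def)
  then show ?thesis by (rule that)
qed

lemma coprime_parallel:
  assumes "coprime (fst r) (snd r)" "coprime (fst r') (snd r')" "det2 r r' = 0"
  shows "r' = r \<or> r' = (- fst r, - snd r)"
proof -
  obtain x y where r: "r = (x, y)" by (cases r)
  obtain z w where r': "r' = (z, w)" by (cases r')
  have c: "coprime x y" "coprime z w" and e: "x * w = y * z"
    using assms by (auto simp: r r' det2_def)
  have "x dvd z" using c(1) e by (metis coprime_dvd_mult_right_iff dvd_triv_left)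
  moreover have "z dvd x" using c(2) e by (metis coprime_dvd_mult_left_iff dvd_triv_right)
  ultimately have "\<bar>x\<bar> = \<bar>z\<bar>" by (metis zdvd_antisym_abs)
  then consider "z = x" | "z = - x" by linarith
  then show ?thesis
  proof cases
    case 1
    show ?thesis
    proof (cases "x = 0")
      case True
      with c 1 show ?thesis by (auto simp: r r')
    next
      case False
      with e 1 show ?thesis by (simp add: r r')
    qed
  next
    case 2
    show ?thesis
    proof (cases "x = 0")
      case True
      with c 2 show ?thesis by (auto simp: r r')
    next
      case False
      have "x * (w + y) = 0" using e 2 by (simp add: algebra_simps)
      with False have "w = - y" by simp
      with 2 show ?thesis by (simp add: r r')
    qed
  qed
qed

text \<open>The vector \<open>(A, -B, C)\<close> of maximal minors of the two rows \<open>(p0, p1, p2)\<close>, \<open>(p1, p2, p3)\<close> is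
  orthogonal to both. If \<open>B\<^sup>2 = 4 A C\<close> and \<open>C \<noteq> 0\<close>, it is proportional to \<open>(u\<^sup>2, -2 u v, v\<^sup>2)\<close>
  with \<open>u / v = B / (2 C)\<close>. If \<open>C = 0\<close>, then \<open>B = 0\<close>, so \<open>p\<close> is a multiple of
  \<open>(1, x, x\<^sup>2, x\<^sup>3)\<close> with \<open>x = p1 / p0\<close>, and \<open>u / v = p1 / p0\<close> works.\<close>

lemma special_if_discr_zero:
  assumes "discr (p0, p1, p2, p3) = 0" "1 \<le> p0"
  shows "special (p0, p1, p2, p3)"
proof -
  define A where "A = p1 * p3 - p2\<^sup>2"
  define B where "B = p0 * p3 - p1 * p2"
  define C where "C = p0 * p2 - p1\<^sup>2"
  have D: "B\<^sup>2 = 4 * A * C" using assms by (simp add: discr_def A_def B_def C_def)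
  have main: "special (p0, p1, p2, p3)"
    if uv: "v \<noteq> 0" "u\<^sup>2 * p0 - 2 * u * v * p1 + v\<^sup>2 * p2 = 0"
      "u\<^sup>2 * p1 - 2 * u * v * p2 + v\<^sup>2 * p3 = 0" for u v
  proof -
    define g where "g = gcd u v"
    obtain u' v' where uv': "u = u' * g" "v = v' * g" "coprime u' v'"
      unfolding g_def using gcd_coprime_exists[of u v] uv(1) by auto
    have g0: "g \<noteq> 0" using uv(1) by (simp add: g_def)
    have "g\<^sup>2 * (u'\<^sup>2 * p0 - 2 * u' * v' * p1 + v'\<^sup>2 * p2) = 0"
      "g\<^sup>2 * (u'\<^sup>2 * p1 - 2 * u' * v' * p2 + v'\<^sup>2 * p3) = 0"
      using uv(2,3) unfolding uv' by algebra+
    then have "u'\<^sup>2 * p0 - 2 * u' * v' * p1 + v'\<^sup>2 * p2 = 0"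
      "u'\<^sup>2 * p1 - 2 * u' * v' * p2 + v'\<^sup>2 * p3 = 0" using g0 by simp_all
    then have "real_of_int (u'\<^sup>2 * p0 - 2 * u' * v' * p1 + v'\<^sup>2 * p2) = 0"
      "real_of_int (u'\<^sup>2 * p1 - 2 * u' * v' * p2 + v'\<^sup>2 * p3) = 0" by simp_all
    then show ?thesis using uv'(3) by (auto simp: special_def L_plane_def)
  qed
  show ?thesis
  proof (cases "C = 0")
    case True
    then have "B = 0" using D by simp
    show ?thesis
    proof (rule main[of p0 p1])
      show "p0 \<noteq> 0" using assms by simp
      show "p1\<^sup>2 * p0 - 2 * p1 * p0 * p1 + p0\<^sup>2 * p2 = 0"
        using True unfolding C_def by algebra
      show "p1\<^sup>2 * p1 - 2 * p1 * p0 * p2 + p0\<^sup>2 * p3 = 0"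
        using True \<open>B = 0\<close> unfolding B_def C_def by algebra
    qed
  next
    case False
    show ?thesis
    proof (rule main[of "2 * C" B])
      show "2 * C \<noteq> 0" using False by simp
      have "A * p0 - B * p1 + C * p2 = 0" "A * p1 - B * p2 + C * p3 = 0"
        unfolding A_def B_def C_def by algebra+
      then show "B\<^sup>2 * p0 - 2 * B * (2 * C) * p1 + (2 * C)\<^sup>2 * p2 = 0"
        "B\<^sup>2 * p1 - 2 * B * (2 * C) * p2 + (2 * C)\<^sup>2 * p3 = 0"
        using D by algebra+
    qed
  qed
qed

section \<open>Depressed form and the neighbourhood of the curve\<close>

definition slope :: "cubic \<Rightarrow> real" where
  "slope = (\<lambda>(p0, p1, p2, p3). of_int p1 / of_int p0)"

text \<open>Completing the cube by \<open>u = X + \<xi> Y\<close>, \<open>v = Y\<close> with \<open>\<xi> = slope p\<close> gives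
  \<open>p0 u\<^sup>3 + 3 (dep2 p) u v\<^sup>2 + (dep3 p) v\<^sup>3\<close>.\<close>

definition dep2 :: "cubic \<Rightarrow> real" where
  "dep2 p = (case p of (p0, p1, p2, p3) \<Rightarrow> of_int p2 - of_int p0 * (slope p)\<^sup>2)"

definition dep3 :: "cubic \<Rightarrow> real" where
  "dep3 p = (case p of (p0, p1, p2, p3) \<Rightarrow>
     of_int p3 - 3 * slope p * of_int p2 + 2 * of_int p0 * slope p ^ 3)"

definition lin :: "real \<Rightarrow> int \<times> int \<Rightarrow> real" where
  "lin \<xi> r = of_int (fst r) + \<xi> * of_int (snd r)"

lemma lin_row_add: "lin \<xi> (row_add s m r) = lin \<xi> s + of_int m * lin \<xi> r"
  by (simp add: lin_def row_add_def algebra_simps)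

lemma det2_lin: "lin \<xi> r * of_int (snd s) - of_int (snd r) * lin \<xi> s = of_int (det2 r s)"
  by (simp add: lin_def det2_def algebra_simps)

lemma depressed_coeffs:
  assumes "p = (p0, p1, p2, p3)" "p0 \<noteq> 0"
  shows "real_of_int p1 = of_int p0 * slope p"
    "real_of_int p2 = dep2 p + of_int p0 * (slope p)\<^sup>2"
    "real_of_int p3 = dep3 p + 3 * slope p * dep2 p + of_int p0 * slope p ^ 3"
proof -
  show "real_of_int p1 = of_int p0 * slope p" using assms by (simp add: slope_def)
  show "real_of_int p2 = dep2 p + of_int p0 * (slope p)\<^sup>2" by (simp add: dep2_def assms(1))
  then show "real_of_int p3 = dep3 p + 3 * slope p * dep2 p + of_int p0 * slope p ^ 3"
    by (simp add: dep2_def dep3_def assms(1) power2_eq_square power3_eq_cube algebra_simps)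
qed

lemma polar_depressed:
  assumes "fst p \<noteq> 0"
  defines "U \<equiv> lin (slope p)"
  shows "real_of_int (polar p r s q) =
     of_int (fst p) * U r * U s * U q
     + dep2 p * (U r * of_int (snd s) * of_int (snd q) + of_int (snd r) * U s * of_int (snd q)
         + of_int (snd r) * of_int (snd s) * U q)
     + dep3 p * of_int (snd r) * of_int (snd s) * of_int (snd q)"
proof -
  obtain p0 p1 p2 p3 where p: "p = (p0, p1, p2, p3)" by (cases p)
  have p0: "p0 \<noteq> 0" using assms by (simp add: p)
  show ?thesis
    unfolding U_def lin_def
    by (cases r; cases s; cases q)
      (simp add: p polar_def depressed_coeffs[OF refl[of "(p0, p1, p2, p3)"] p0] power2_eq_square power3_eq_cube
        algebra_simps)
qed

lemma hess_depressed:
  assumes "fst p \<noteq> 0"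
  shows "real_of_int (hess p r) =
     of_int (fst p) * dep2 p * (lin (slope p) r)\<^sup>2
     + of_int (fst p) * dep3 p * lin (slope p) r * of_int (snd r)
     - (dep2 p)\<^sup>2 * (of_int (snd r))\<^sup>2"
proof -
  obtain p0 p1 p2 p3 where p: "p = (p0, p1, p2, p3)" by (cases p)
  have p0: "p0 \<noteq> 0" using assms by (simp add: p)
  show ?thesis
    unfolding lin_def
    by (cases r)
      (simp add: p hess_def depressed_coeffs[OF refl[of "(p0, p1, p2, p3)"] p0] power2_eq_square power3_eq_cube
        algebra_simps)
qed

lemma dep2_times_lead:
  assumes "p0 \<noteq> 0"
  shows "of_int p0 * dep2 (p0, p1, p2, p3) = of_int (p0 * p2 - p1\<^sup>2)"
  using assms by (simp add: dep2_def slope_def field_simps power2_eq_square)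

text \<open>For \<open>\<eta> = 1\<close> and \<open>c\<close> large this contains the points with nonzero discriminant and leading
  coefficient in \<open>(Q / 2, Q]\<close> that lie within \<open>\<delta>\<close> of the cone over a fixed piece of the curve. The
  parameter \<open>\<eta>\<close> constrains only \<open>dep3\<close>, which governs how often an orbit can return.\<close>

definition region :: "real \<Rightarrow> real \<Rightarrow> real \<Rightarrow> real \<Rightarrow> cubic set" where
  "region c Q \<delta> \<eta> = {p. Q / 2 < of_int (fst p) \<and> of_int (fst p) \<le> Q \<and> \<bar>slope p\<bar> \<le> c \<and>
     \<bar>dep2 p\<bar> \<le> c * \<delta> \<and> \<bar>dep3 p\<bar> \<le> c * \<eta> * \<delta> \<and> discr p \<noteq> 0}"

lemma finite_abs_int: "finite {x :: int. \<bar>real_of_int x\<bar> \<le> B}"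
proof (rule finite_subset)
  show "{x :: int. \<bar>real_of_int x\<bar> \<le> B} \<subseteq> {- \<lfloor>B\<rfloor>..\<lfloor>B\<rfloor>}"
    by (auto simp: abs_le_iff) linarith+
qed simp

lemma card_abs_int:
  assumes "0 \<le> B"
  shows "real (card {x :: int. \<bar>real_of_int x\<bar> \<le> B}) \<le> 2 * B + 1"
proof -
  have "{x :: int. \<bar>real_of_int x\<bar> \<le> B} \<subseteq> {- \<lfloor>B\<rfloor>..\<lfloor>B\<rfloor>}"
    by (auto simp: abs_le_iff) linarith+
  then have "card {x :: int. \<bar>real_of_int x\<bar> \<le> B} \<le> card {- \<lfloor>B\<rfloor>..\<lfloor>B\<rfloor>}"
    by (intro card_mono) auto
  also have "\<dots> = nat (2 * \<lfloor>B\<rfloor> + 1)" by simp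
  finally have "real (card {x :: int. \<bar>real_of_int x\<bar> \<le> B}) \<le> real (nat (2 * \<lfloor>B\<rfloor> + 1))"
    by linarith
  also have "\<dots> = 2 * of_int \<lfloor>B\<rfloor> + 1" using assms by simp
  also have "\<dots> \<le> 2 * B + 1" by linarith
  finally show ?thesis .
qed

lemma card_abs_int':
  assumes "1 \<le> B"
  shows "real (card {x :: int. \<bar>real_of_int x\<bar> \<le> B}) \<le> 3 * B"
  using card_abs_int[of B] assms by linarith

lemma finite_region: "finite (region c Q \<delta> \<eta>)"
proof -
  define B where "B = max Q (max (\<bar>Q\<bar> * c) (max (c * \<delta> + \<bar>Q\<bar> * c\<^sup>2)
    (c * \<eta> * \<delta> + 3 * (c * (c * \<delta>)) + \<bar>Q\<bar> * c ^ 3)))"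
  let ?Z = "{x :: int. \<bar>real_of_int x\<bar> \<le> B}"
  have "region c Q \<delta> \<eta> \<subseteq> ?Z \<times> ?Z \<times> ?Z \<times> ?Z"
  proof (rule subsetI)
    fix p assume "p \<in> region c Q \<delta> \<eta>"
    moreover obtain p0 p1 p2 p3 where p: "p = (p0, p1, p2, p3)" by (cases p)
    ultimately have 1: "(p0, p1, p2, p3) \<in> region c Q \<delta> \<eta>" by simp
    let ?p = "(p0, p1, p2, p3)"
    have h: "Q / 2 < of_int p0" "of_int p0 \<le> Q" "\<bar>slope ?p\<bar> \<le> c" "\<bar>dep2 ?p\<bar> \<le> c * \<delta>"
      "\<bar>dep3 ?p\<bar> \<le> c * \<eta> * \<delta>" using 1 by (auto simp: region_def)
    have p0: "0 < real_of_int p0" "p0 \<noteq> 0" using h(1,2) by auto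
    have c: "0 \<le> c" using h(3) by linarith
    note co = depressed_coeffs[OF refl[of ?p] p0(2)]
    have q: "\<bar>real_of_int p0\<bar> \<le> \<bar>Q\<bar>" using h(2) p0 by linarith
    have b0: "\<bar>real_of_int p0\<bar> \<le> B" using h(2) p0 unfolding B_def by linarith
    have "\<bar>real_of_int p1\<bar> \<le> \<bar>Q\<bar> * c"
      unfolding co(1) abs_mult by (intro mult_mono q h) (use c in auto)
    then have b1: "\<bar>real_of_int p1\<bar> \<le> B" unfolding B_def by linarith
    have s2: "\<bar>slope ?p\<bar> ^ k \<le> c ^ k" for k by (intro power_mono h) auto
    have "\<bar>real_of_int p2\<bar> \<le> \<bar>dep2 ?p\<bar> + \<bar>real_of_int p0\<bar> * \<bar>slope ?p\<bar>\<^sup>2"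
    proof -
      have "\<bar>of_int p0 * (slope ?p)\<^sup>2\<bar> = \<bar>real_of_int p0\<bar> * \<bar>slope ?p\<bar>\<^sup>2"
        by (simp add: abs_mult)
      then show ?thesis unfolding co(2) by linarith
    qed
    also have "\<dots> \<le> c * \<delta> + \<bar>Q\<bar> * c\<^sup>2"
      by (intro add_mono mult_mono q h s2) (use c in auto)
    finally have b2: "\<bar>real_of_int p2\<bar> \<le> B" unfolding B_def by linarith
    have "\<bar>real_of_int p3\<bar> \<le> \<bar>dep3 ?p\<bar> + 3 * (\<bar>slope ?p\<bar> * \<bar>dep2 ?p\<bar>) + \<bar>real_of_int p0\<bar> * \<bar>slope ?p\<bar> ^ 3"
    proof -
      have "\<bar>3 * slope ?p * dep2 ?p\<bar> = 3 * (\<bar>slope ?p\<bar> * \<bar>dep2 ?p\<bar>)"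
        "\<bar>of_int p0 * slope ?p ^ 3\<bar> = \<bar>real_of_int p0\<bar> * \<bar>slope ?p\<bar> ^ 3"
        by (simp_all add: abs_mult power_abs)
      then show ?thesis unfolding co(3) by linarith
    qed
    also have "\<dots> \<le> c * \<eta> * \<delta> + 3 * (c * (c * \<delta>)) + \<bar>Q\<bar> * c ^ 3"
      by (intro add_mono mult_mono mult_left_mono q h s2) (use c in auto)
    finally have b3: "\<bar>real_of_int p3\<bar> \<le> B" unfolding B_def by linarith
    show "p \<in> ?Z \<times> ?Z \<times> ?Z \<times> ?Z" using b0 b1 b2 b3 by (simp add: p)
  qed
  then show ?thesis by (rule finite_subset) (intro finite_cartesian_product finite_abs_int)
qed

text \<open>Two matrices of determinant 1 with the same first row differ by a translation, which shifts
  \<open>slope\<close> by an integer. So a point is determined by the first row and the integer part of its slope.\<close>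

lemma orbit_fibre_card:
  assumes R: "finite R" and c: "0 \<le> c"
    and F: "\<And>p. p \<in> F \<Longrightarrow> 0 < fst p \<and> \<bar>slope p\<bar> \<le> c \<and> (\<exists>r\<in>R. \<exists>s. det2 r s = 1 \<and> p = act r s f)"
  shows "finite F" "real (card F) \<le> real (card R) * (2 * c + 3)"
proof -
  obtain \<rho> where \<rho>: "\<And>p. p \<in> F \<Longrightarrow> \<rho> p \<in> R \<and> (\<exists>s. det2 (\<rho> p) s = 1 \<and> p = act (\<rho> p) s f)"
    using F by metis
  let ?Z = "{x :: int. \<bar>real_of_int x\<bar> \<le> c + 1}"
  let ?h = "\<lambda>p. (\<rho> p, \<lfloor>slope p\<rfloor>)"
  have inj: "inj_on ?h F"
  proof (rule inj_onI)
    fix p p' assume pp: "p \<in> F" "p' \<in> F" "?h p = ?h p'"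
    define r where "r = \<rho> p"
    obtain s where s: "det2 r s = 1" "p = act r s f" using \<rho>[OF pp(1)] r_def by blast
    obtain s' where s': "det2 r s' = 1" "p' = act r s' f" 
    proof -
      have "\<rho> p' = r" using pp(3) by (simp add: r_def)
      with \<rho>[OF pp(2)] that show ?thesis by blast
    qed
    obtain m where m: "s' = row_add s m r" using det2_same_row[OF s(1) s'(1)] .
    obtain p0 p1 p2 p3 where p: "p = (p0, p1, p2, p3)" by (cases p)
    have p': "p' = (p0, p1 + m * p0, p2 + 2 * m * p1 + m\<^sup>2 * p0, p3 + 3 * m * p2 + 3 * m\<^sup>2 * p1 + m ^ 3 * p0)"
      unfolding s'(2) m by (rule act_row_add) (use s(2) p in metis)
    have "p0 > 0" using F[OF pp(1)] by (simp add: p)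
    then have "slope p' = slope p + of_int m" by (simp add: p p' slope_def field_simps)
    then have "m = 0" using pp(3) by simp
    then show "p = p'" by (simp add: p p')
  qed
  have sub: "?h ` F \<subseteq> R \<times> ?Z"
  proof (rule image_subsetI)
    fix p assume p: "p \<in> F"
    have "\<bar>slope p\<bar> \<le> c" using F[OF p] by blast
    then have "\<bar>real_of_int \<lfloor>slope p\<rfloor>\<bar> \<le> c + 1" by linarith
    then show "?h p \<in> R \<times> ?Z" using \<rho>[OF p] by simp
  qed
  have fin: "finite (R \<times> ?Z)" using R finite_abs_int by blast
  show "finite F" by (rule finite_imageD[OF finite_subset[OF sub fin] inj])
  have "card F = card (?h ` F)" using inj by (simp add: card_image)
  also have "\<dots> \<le> card (R \<times> ?Z)" by (rule card_mono[OF fin sub])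
  finally have "real (card F) \<le> real (card R) * real (card ?Z)"
    by (simp add: card_cartesian_product flip: of_nat_mult)
  also have "\<dots> \<le> real (card R) * (2 * c + 3)"
    by (intro mult_left_mono order_trans[OF card_abs_int]) (use c in auto)
  finally show "real (card F) \<le> real (card R) * (2 * c + 3)" .
qed

section \<open>Primitive vectors in a parallelogram\<close>

lemma close_slopes:
  fixes u v u' v' :: real
  assumes u: "0 < \<bar>u\<bar>" "\<bar>u\<bar> \<le> a" "0 < \<bar>u'\<bar>" "\<bar>u'\<bar> \<le> a"
    and fl: "\<lfloor>2 * a\<^sup>2 * (v / u)\<rfloor> = \<lfloor>2 * a\<^sup>2 * (v' / u')\<rfloor>"
  shows "\<bar>u * v' - u' * v\<bar> < 1 / 2"
proof -
  have a: "0 < a" using u by linarith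
  have "\<bar>2 * a\<^sup>2 * (v / u) - 2 * a\<^sup>2 * (v' / u')\<bar> < 1" using fl by linarith
  also have "2 * a\<^sup>2 * (v / u) - 2 * a\<^sup>2 * (v' / u') = 2 * a\<^sup>2 * (v / u - v' / u')"
    by (simp only: right_diff_distrib)
  finally have "2 * a\<^sup>2 * \<bar>v / u - v' / u'\<bar> < 1" by (simp only: abs_mult) simp
  then have 1: "\<bar>v / u - v' / u'\<bar> < 1 / (2 * a\<^sup>2)" using a by (simp add: field_simps)
  have "\<bar>u * v' - u' * v\<bar> = \<bar>u\<bar> * \<bar>u'\<bar> * \<bar>v / u - v' / u'\<bar>"
  proof -
    have "u * v' - u' * v = - (u * u' * (v / u - v' / u'))"
      using u by (simp add: field_simps)
    then show ?thesis by (simp only: abs_minus_cancel abs_mult)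
  qed
  also have "\<dots> \<le> (a * a) * \<bar>v / u - v' / u'\<bar>"
    by (intro mult_right_mono mult_mono) (use u a in auto)
  also have "\<dots> < (a * a) * (1 / (2 * a\<^sup>2))" using a 1 by (intro mult_strict_left_mono) auto
  also have "\<dots> = 1 / 2" using a by (simp add: power2_eq_square)
  finally show ?thesis .
qed

text \<open>Nonparallel integer vectors have determinant at least 1 in absolute value, which forces their
  slopes \<open>V / U\<close> to be separated by \<open>1 / (2 a\<^sup>2)\<close>; in the half of the parallelogram where \<open>U\<close>
  dominates, the slopes fill an interval of length \<open>2 b / a\<close>. A primitive vector is determined by its
  slope and the sign of \<open>U\<close>.\<close>

lemma primitive_half_cone:
  fixes U V :: "int \<times> int \<Rightarrow> real"
  assumes U: "\<And>r. U (- fst r, - snd r) = - U r"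
    and det: "\<And>r r'. \<bar>U r * V r' - U r' * V r\<bar> \<ge> \<bar>of_int (det2 r r')\<bar> / 2"
    and a: "0 < a" and b: "0 < b"
  defines "H \<equiv> {r. coprime (fst r) (snd r) \<and> \<bar>U r\<bar> \<le> a \<and> \<bar>V r\<bar> * a \<le> \<bar>U r\<bar> * b}"
  shows "finite H" "real (card H) \<le> 8 * a * b + 6"
proof -
  let ?Z = "{x :: int. \<bar>real_of_int x\<bar> \<le> 2 * a * b + 1}"
  let ?h = "\<lambda>r. (0 < U r, \<lfloor>2 * a\<^sup>2 * (V r / U r)\<rfloor>)"
  have nz: "0 < \<bar>U r\<bar>" if "r \<in> H" for r
  proof (rule ccontr)
    assume "\<not> 0 < \<bar>U r\<bar>"
    then have "U r = 0" by simp
    moreover have "\<bar>V r\<bar> * a \<le> 0" using that \<open>U r = 0\<close> by (simp add: H_def)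
    then have "V r = 0" using a by (simp add: mult_le_0_iff)
    ultimately have "\<bar>real_of_int (det2 r r')\<bar> \<le> 0" for r' using det[of r r'] by simp
    then have "det2 r (1, 0) = 0" "det2 r (0, 1) = 0" by simp_all
    then have "fst r = 0" "snd r = 0" by (simp_all add: det2_def)
    then show False using that by (simp add: H_def)
  qed
  have inj: "inj_on ?h H"
  proof (rule inj_onI)
    fix r r' assume rr: "r \<in> H" "r' \<in> H" and e: "?h r = ?h r'"
    have "\<bar>U r * V r' - U r' * V r\<bar> < 1 / 2"
      by (rule close_slopes[of _ a]) (use nz rr e in \<open>auto simp: H_def\<close>)
    then have "\<bar>real_of_int (det2 r r')\<bar> < 1" using det[of r r'] by linarith
    then have "det2 r r' = 0" by linarith
    then have "r' = r \<or> r' = (- fst r, - snd r)"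
      using rr by (intro coprime_parallel) (auto simp: H_def)
    moreover have "r' \<noteq> (- fst r, - snd r)"
    proof
      assume "r' = (- fst r, - snd r)"
      then have "U r' = - U r" using U by simp
      then show False using e nz[OF rr(1)] by auto
    qed
    ultimately show "r = r'" by simp
  qed
  have sub: "?h ` H \<subseteq> UNIV \<times> ?Z"
  proof (rule image_subsetI)
    fix r assume r: "r \<in> H"
    have "\<bar>V r\<bar> * a \<le> \<bar>U r\<bar> * b" using r by (simp add: H_def)
    then have "\<bar>V r\<bar> / \<bar>U r\<bar> \<le> b / a" using nz[OF r] a by (simp add: field_simps)
    then have "2 * a\<^sup>2 * (\<bar>V r\<bar> / \<bar>U r\<bar>) \<le> 2 * a\<^sup>2 * (b / a)" by (intro mult_left_mono) auto
    also have "\<dots> = 2 * a * b" using a by (simp add: power2_eq_square)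
    finally have "\<bar>2 * a\<^sup>2 * (V r / U r)\<bar> \<le> 2 * a * b" by (simp add: abs_mult)
    then have "\<bar>real_of_int \<lfloor>2 * a\<^sup>2 * (V r / U r)\<rfloor>\<bar> \<le> 2 * a * b + 1" by linarith
    then show "?h r \<in> UNIV \<times> ?Z" by simp
  qed
  have fin: "finite ((UNIV :: bool set) \<times> ?Z)" using finite_abs_int[of "2 * a * b + 1"] by simp
  show "finite H" by (rule finite_imageD[OF finite_subset[OF sub fin] inj])
  have "card H = card (?h ` H)" using inj by (simp add: card_image)
  also have "\<dots> \<le> card ((UNIV :: bool set) \<times> ?Z)" by (rule card_mono[OF fin sub])
  finally have "real (card H) \<le> 2 * real (card ?Z)"
    by (simp add: card_cartesian_product card_UNIV_bool)
  also have "\<dots> \<le> 2 * (2 * (2 * a * b + 1) + 1)"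
    by (intro mult_left_mono card_abs_int) (use a b in auto)
  finally show "real (card H) \<le> 8 * a * b + 6" by simp
qed

lemma primitive_in_parallelogram:
  fixes U V :: "int \<times> int \<Rightarrow> real"
  assumes U: "\<And>r. U (- fst r, - snd r) = - U r" and V: "\<And>r. V (- fst r, - snd r) = - V r"
    and det: "\<And>r r'. \<bar>U r * V r' - U r' * V r\<bar> \<ge> \<bar>of_int (det2 r r')\<bar> / 2"
    and a: "0 < a" and b: "0 < b"
  defines "H \<equiv> {r. coprime (fst r) (snd r) \<and> \<bar>U r\<bar> \<le> a \<and> \<bar>V r\<bar> \<le> b}"
  shows "finite H" "real (card H) \<le> 16 * a * b + 12"
proof -
  define H1 where "H1 = {r. coprime (fst r) (snd r) \<and> \<bar>U r\<bar> \<le> a \<and> \<bar>V r\<bar> * a \<le> \<bar>U r\<bar> * b}"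
  define H2 where "H2 = {r. coprime (fst r) (snd r) \<and> \<bar>V r\<bar> \<le> b \<and> \<bar>U r\<bar> * b \<le> \<bar>V r\<bar> * a}"
  have det': "\<bar>V r * U r' - V r' * U r\<bar> \<ge> \<bar>of_int (det2 r r')\<bar> / 2" for r r'
    using det[of r r'] by (simp add: abs_minus_commute mult.commute)
  have f1: "finite H1" "real (card H1) \<le> 8 * a * b + 6"
    unfolding H1_def by (rule primitive_half_cone[OF U det a b])+
  have f2: "finite H2" "real (card H2) \<le> 8 * b * a + 6"
    unfolding H2_def by (rule primitive_half_cone[OF V det' b a])+
  have sub: "H \<subseteq> H1 \<union> H2" by (auto simp: H_def H1_def H2_def)
  then show "finite H" by (rule finite_subset) (simp add: f1 f2)
  have "card H \<le> card (H1 \<union> H2)" using sub f1 f2 by (intro card_mono) auto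
  also have "\<dots> \<le> card H1 + card H2" by (rule card_Un_le)
  finally have "real (card H) \<le> real (card H1) + real (card H2)" by linarith
  also have "\<dots> \<le> 16 * a * b + 12" using f1(2) f2(2) by (simp add: mult.commute[of b a] mult.assoc)
  finally show "real (card H) \<le> 16 * a * b + 12" .
qed

section \<open>Reduced bases\<close>

lemma dyadic_between:
  fixes X :: real
  assumes "0 < X" "X \<le> 2"
  obtains j :: nat where "1 / 2 ^ j < X" "X \<le> 2 / 2 ^ j"
proof -
  have ex: "\<exists>j. 1 / 2 ^ j < X"
    using real_arch_pow_inv[of X "1/2"] assms by (auto simp: power_one_over)
  define j where "j = (LEAST j. 1 / 2 ^ j < X)"
  have j: "1 / 2 ^ j < X" unfolding j_def by (rule LeastI_ex[OF ex])
  have "X \<le> 2 / 2 ^ j"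
  proof (cases j)
    case 0
    then show ?thesis using assms by simp
  next
    case (Suc i)
    then have "\<not> 1 / 2 ^ i < X" using not_less_Least[of i "\<lambda>j. 1 / 2 ^ j < X"] by (simp add: j_def)
    then show ?thesis using Suc by simp
  qed
  with j show ?thesis by (rule that)
qed

text \<open>Rounding makes the component along the longer coordinate of the first vector small; the
  determinant then controls the other component.\<close>

lemma shear_second_row:
  fixes x1 x2 y1 y2 :: real
  assumes det: "x1 * y2 - x2 * y1 = 1" and X: "\<bar>x2\<bar> \<le> \<bar>x1\<bar>" "\<bar>x1\<bar> \<le> 2"
  obtains m :: int where "\<bar>y1 + of_int m * x1\<bar> \<le> 3 / \<bar>x1\<bar>" "\<bar>y2 + of_int m * x2\<bar> \<le> 3 / \<bar>x1\<bar>"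
proof -
  have x1: "0 < \<bar>x1\<bar>" using det X by (cases "x1 = 0") auto
  define m where "m = - round (y1 / x1)"
  define z1 where "z1 = y1 + of_int m * x1"
  define z2 where "z2 = y2 + of_int m * x2"
  have "\<bar>y1 / x1 + of_int m\<bar> \<le> 1 / 2"
    using of_int_round_abs_le[of "y1 / x1"] by (simp add: m_def abs_minus_commute)
  moreover have "z1 = x1 * (y1 / x1 + of_int m)" using x1 by (simp add: z1_def field_simps)
  ultimately have z1: "\<bar>z1\<bar> \<le> \<bar>x1\<bar> * (1 / 2)" by (simp only: abs_mult mult_left_mono abs_ge_zero)
  have "x1 * z2 - x2 * z1 = 1" using det by (simp add: z1_def z2_def algebra_simps)
  then have "\<bar>x1\<bar> * \<bar>z2\<bar> = \<bar>1 + x2 * z1\<bar>" by (simp add: flip: abs_mult)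
  also have "\<dots> \<le> 1 + \<bar>x2\<bar> * \<bar>z1\<bar>" using abs_triangle_ineq[of 1 "x2 * z1"] by (simp add: abs_mult)
  also have "\<dots> \<le> 1 + 2 * (2 * (1 / 2))" using X z1 by (intro add_mono mult_mono) auto
  finally have "\<bar>z2\<bar> \<le> 3 / \<bar>x1\<bar>" using x1 by (simp add: field_simps)
  moreover have "\<bar>z1\<bar> \<le> 3 / \<bar>x1\<bar>"
  proof -
    have "\<bar>z1\<bar> * \<bar>x1\<bar> \<le> (\<bar>x1\<bar> * (1 / 2)) * \<bar>x1\<bar>" by (intro mult_right_mono z1) simp
    also have "\<dots> \<le> (2 * (1 / 2)) * 2" using X by (intro mult_mono) auto
    finally show ?thesis using x1 by (simp add: field_simps)
  qed
  ultimately show ?thesis using that[of m] by (simp add: z1_def z2_def)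
qed

text \<open>Reduction of the lattice spanned by \<open>(t, 0)\<close> and \<open>(t \<xi>, 1 / t)\<close>. The first vector is a
  primitive vector of length at most 2, supplied by Dirichlet approximation of \<open>\<xi>\<close>. The second
  vector is taken as short as the covolume 1 permits, about the inverse length \<open>2\<^sup>j\<close> of the first,
  so that adding up to \<open>4\<^sup>j\<close> copies of the first does not change its order of magnitude.\<close>

lemma reduced_frame:
  fixes \<xi> t :: real
  assumes t: "1 \<le> t"
  obtains r s and j :: nat where "det2 r s = 1"
    "\<bar>t * lin \<xi> r\<bar> \<le> 2 / 2 ^ j" "\<bar>of_int (snd r) / t\<bar> \<le> 2 / 2 ^ j"
    "\<And>k. k < 4 ^ j \<Longrightarrow> \<bar>t * lin \<xi> (row_add s (int k) r)\<bar> \<le> 5 * 2 ^ j \<and>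
        \<bar>of_int (snd (row_add s (int k) r)) / t\<bar> \<le> 5 * 2 ^ j"
proof -
  let ?u = "\<lambda>r. t * lin \<xi> r" and ?v = "\<lambda>r :: int \<times> int. of_int (snd r) / t :: real"
  define N where "N = nat \<lfloor>t\<rfloor>"
  have "1 \<le> \<lfloor>t\<rfloor>" using t by simp
  then have N: "0 < N" "real N \<le> t" "t \<le> 2 * real N"
    unfolding N_def by linarith+
  obtain h k where hk: "coprime h k" "0 < k" "k \<le> int N" "\<bar>of_int k * \<xi> - of_int h\<bar> < 1 / N"
    using Dirichlet_approx_coprime[OF N(1)] by metis
  define r where "r = (- h, k)"
  obtain x y where xy: "x * (- h) + y * k = 1"
    using hk(1) bezout_int[of "- h" k] by auto
  define s where "s = (- y, x)"
  have rs: "det2 r s = 1" using xy by (simp add: r_def s_def det2_def algebra_simps)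
  define X where "X = max \<bar>?u r\<bar> \<bar>?v r\<bar>"
  have "\<bar>?u r\<bar> = t * \<bar>of_int k * \<xi> - of_int h\<bar>"
    using t by (simp add: lin_def r_def abs_mult mult.commute)
  also have "\<dots> \<le> t * (1 / N)" by (intro mult_left_mono) (use hk t in auto)
  also have "\<dots> \<le> 2" using N by (simp add: field_simps)
  finally have u2: "\<bar>?u r\<bar> \<le> 2" .
  have "of_int k \<le> t" using hk(3) N(2) by linarith
  then have v2: "\<bar>?v r\<bar> \<le> 2" using t hk(2) by (simp add: r_def field_simps)
  have "0 < \<bar>?v r\<bar>" using hk(2) t by (simp add: r_def)
  then have X: "0 < X" "X \<le> 2" using u2 v2 by (auto simp: X_def)
  obtain j where j: "1 / 2 ^ j < X" "X \<le> 2 / 2 ^ j" using dyadic_between[OF X] .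
  have det: "?u r * ?v s - ?v r * ?u s = 1" if "det2 r s = 1" for s
  proof -
    have "?u r * ?v s - ?v r * ?u s = of_int (det2 r s)"
      unfolding det2_lin[of \<xi>, symmetric] using t by (simp add: field_simps)
    then show ?thesis using that by simp
  qed
  have "\<exists>m. \<bar>?u s + of_int m * ?u r\<bar> \<le> 3 / X \<and> \<bar>?v s + of_int m * ?v r\<bar> \<le> 3 / X"
  proof (cases "\<bar>?v r\<bar> \<le> \<bar>?u r\<bar>")
    case True
    then have "X = \<bar>?u r\<bar>" by (simp add: X_def)
    with shear_second_row[OF det[OF rs] True u2] show ?thesis by metis
  next
    case False
    then have *: "X = \<bar>?v r\<bar>" "\<bar>- ?u r\<bar> \<le> \<bar>?v r\<bar>" by (simp_all add: X_def)
    have "?v r * (- ?u s) - (- ?u r) * ?v s = 1" using det[OF rs] by (simp add: algebra_simps)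
    from shear_second_row[OF this *(2) v2] obtain m :: int where
      "\<bar>?v s + of_int m * ?v r\<bar> \<le> 3 / X" "\<bar>- ?u s + of_int m * - ?u r\<bar> \<le> 3 / X"
      using * by metis
    moreover have "\<bar>- ?u s + of_int m * - ?u r\<bar> = \<bar>?u s + of_int m * ?u r\<bar>" by linarith
    ultimately show ?thesis by metis
  qed
  then obtain m where m: "\<bar>?u s + of_int m * ?u r\<bar> \<le> 3 / X" "\<bar>?v s + of_int m * ?v r\<bar> \<le> 3 / X" by blast
  define s' where "s' = row_add s m r"
  have us: "?u (row_add z i r) = ?u z + of_int i * ?u r" for z i by (simp add: lin_row_add algebra_simps)
  have vs: "?v (row_add z i r) = ?v z + of_int i * ?v r" for z i
    by (simp add: row_add_def add_divide_distrib)
  have X3: "3 / X \<le> 3 * 2 ^ j" using j(1) X by (simp add: field_simps)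
  show ?thesis
  proof (rule that[of r s' j])
    show "det2 r s' = 1" by (simp add: s'_def det2_row_add rs)
    show "\<bar>?u r\<bar> \<le> 2 / 2 ^ j" "\<bar>?v r\<bar> \<le> 2 / 2 ^ j" using j(2) by (auto simp: X_def)
    fix k :: nat assume k: "k < 4 ^ j"
    have kX: "real k * X \<le> 2 * 2 ^ j"
    proof -
      have "real k \<le> 4 ^ j" using k by (metis less_imp_le of_nat_le_iff of_nat_numeral of_nat_power)
      then have "real k * X \<le> 4 ^ j * (2 / 2 ^ j)" using j(2) X by (intro mult_mono) auto
      also have "\<dots> = 2 * 2 ^ j"
        by (simp add: field_simps flip: power_mult_distrib)
      finally show ?thesis .
    qed
    have "\<bar>?u r\<bar> \<le> X" "\<bar>?v r\<bar> \<le> X" unfolding X_def by (rule max.cobounded1 max.cobounded2)+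
    then have "real k * \<bar>?u r\<bar> \<le> real k * X" "real k * \<bar>?v r\<bar> \<le> real k * X"
      by (intro mult_left_mono; simp)+
    then have "\<bar>of_int (int k) * ?u r\<bar> \<le> real k * X" "\<bar>of_int (int k) * ?v r\<bar> \<le> real k * X"
      by (simp_all only: abs_mult of_int_of_nat_eq abs_of_nat)
    moreover have "\<bar>?u s'\<bar> \<le> 3 / X" "\<bar>?v s'\<bar> \<le> 3 / X"
      using m unfolding s'_def us vs by auto
    ultimately show "\<bar>?u (row_add s' (int k) r)\<bar> \<le> 5 * 2 ^ j \<and> \<bar>?v (row_add s' (int k) r)\<bar> \<le> 5 * 2 ^ j"
      unfolding us vs using kX X3 by linarith
  qed
qed

section \<open>Counting forms in the cusp boxes\<close>

definition cusp_box :: "real \<Rightarrow> nat \<Rightarrow> cubic set" where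
  "cusp_box Z j = {(f0, f1, f2, f3). \<bar>real_of_int f0\<bar> \<le> Z / 8 ^ j \<and> \<bar>real_of_int f1\<bar> \<le> Z / 2 ^ j \<and>
     \<bar>real_of_int f2\<bar> \<le> Z * 2 ^ j \<and> \<bar>real_of_int f3\<bar> \<le> Z * 8 ^ j \<and> (f0 \<noteq> 0 \<or> f1 \<noteq> 0)}"

text \<open>Points with \<open>f0 \<noteq> 0\<close> exist only if the shortest side has length at least 1, and then their number
  is bounded by the volume. Points with \<open>f0 = 0\<close> are counted in the other three coordinates, where
  \<open>f1 \<noteq> 0\<close> forces \<open>2\<^sup>j \<le> Z\<close>.\<close>

lemma cusp_box_card:
  assumes "0 \<le> Z"
  shows "finite (cusp_box Z j)"
    "real (card (cusp_box Z j)) \<le> 81 * Z ^ 4 + (if 2 ^ j \<le> Z then 27 * Z ^ 3 * 8 ^ j else 0)"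
proof -
  let ?I = "\<lambda>B. {x :: int. \<bar>real_of_int x\<bar> \<le> B}"
  define X where "X = (if 8 ^ j \<le> Z then ?I (Z / 8 ^ j) \<times> ?I (Z / 2 ^ j) \<times> ?I (Z * 2 ^ j) \<times> ?I (Z * 8 ^ j) else {})"
  define Y where "Y = (if 2 ^ j \<le> Z then {0 :: int} \<times> ?I (Z / 2 ^ j) \<times> ?I (Z * 2 ^ j) \<times> ?I (Z * 8 ^ j) else {})"
  have fin: "finite X" "finite Y" by (auto simp: X_def Y_def finite_abs_int)
  have sub: "cusp_box Z j \<subseteq> X \<union> Y"
  proof (rule subsetI)
    fix f assume f: "f \<in> cusp_box Z j"
    obtain f0 f1 f2 f3 where [simp]: "f = (f0, f1, f2, f3)" by (cases f)
    show "f \<in> X \<union> Y"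
    proof (cases "f0 = 0")
      case True
      then have "1 \<le> \<bar>f1\<bar>" using f by (auto simp: cusp_box_def)
      then have "1 \<le> \<bar>real_of_int f1\<bar>" by linarith
      moreover have "\<bar>real_of_int f1\<bar> \<le> Z / 2 ^ j" using f by (simp add: cusp_box_def)
      ultimately have "1 \<le> Z / 2 ^ j" by linarith
      then have "2 ^ j \<le> Z" by (simp add: field_simps)
      then show ?thesis using f True by (auto simp: cusp_box_def Y_def)
    next
      case False
      then have "1 \<le> \<bar>real_of_int f0\<bar>" by linarith
      moreover have "\<bar>real_of_int f0\<bar> \<le> Z / 8 ^ j" using f by (simp add: cusp_box_def)
      ultimately have "1 \<le> Z / 8 ^ j" by linarith
      then have "8 ^ j \<le> Z" by (simp add: field_simps)
      then show ?thesis using f by (auto simp: cusp_box_def X_def)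
    qed
  qed
  show "finite (cusp_box Z j)" by (rule finite_subset[OF sub]) (simp add: fin)
  have "(2 :: real) ^ j \<le> 8 ^ j" "(1 :: real) \<le> 2 ^ j" "(1 :: real) \<le> 8 ^ j" by (auto intro: power_mono)
  note pw = this
  have big: "1 \<le> Z / 2 ^ j" "1 \<le> Z * 2 ^ j" "1 \<le> Z * 8 ^ j" if "2 ^ j \<le> Z"
  proof -
    have "1 \<le> Z" using that pw by linarith
    show "1 \<le> Z / 2 ^ j" using that by (simp add: field_simps)
    show "1 \<le> Z * 2 ^ j" "1 \<le> Z * 8 ^ j"
      using mult_mono[of 1 Z 1 "2 ^ j"] mult_mono[of 1 Z 1 "8 ^ j"] \<open>1 \<le> Z\<close> pw by auto
  qed
  have X: "real (card X) \<le> 81 * Z ^ 4"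
  proof (cases "8 ^ j \<le> Z")
    case True
    then have "2 ^ j \<le> Z" using pw by linarith
    have "1 \<le> Z / 8 ^ j" using True by (simp add: field_simps)
    have "real (card X) = real (card (?I (Z / 8 ^ j))) * (real (card (?I (Z / 2 ^ j))) *
        (real (card (?I (Z * 2 ^ j))) * real (card (?I (Z * 8 ^ j)))))"
      using True by (simp add: X_def card_cartesian_product)
    also have "\<dots> \<le> (3 * (Z / 8 ^ j)) * ((3 * (Z / 2 ^ j)) * ((3 * (Z * 2 ^ j)) * (3 * (Z * 8 ^ j))))"
      by (intro mult_mono card_abs_int' big[OF \<open>2 ^ j \<le> Z\<close>] \<open>1 \<le> Z / 8 ^ j\<close>) (use assms in auto)
    also have "\<dots> = 81 * Z ^ 4" by (simp add: power4_eq_xxxx)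
    finally show ?thesis .
  qed (simp add: X_def)
  have Y: "real (card Y) \<le> (if 2 ^ j \<le> Z then 27 * Z ^ 3 * 8 ^ j else 0)"
  proof (cases "2 ^ j \<le> Z")
    case True
    have "real (card Y) = real (card (?I (Z / 2 ^ j))) *
        (real (card (?I (Z * 2 ^ j))) * real (card (?I (Z * 8 ^ j))))"
      using True by (simp add: Y_def card_cartesian_product)
    also have "\<dots> \<le> (3 * (Z / 2 ^ j)) * ((3 * (Z * 2 ^ j)) * (3 * (Z * 8 ^ j)))"
      by (intro mult_mono card_abs_int' big[OF True]) (use assms in auto)
    also have "\<dots> = 27 * Z ^ 3 * 8 ^ j" by (simp add: power3_eq_cube)
    finally show ?thesis using True by simp
  qed (simp add: Y_def)
  have "card (cusp_box Z j) \<le> card (X \<union> Y)" using sub fin by (intro card_mono) auto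
  also have "\<dots> \<le> card X + card Y" by (rule card_Un_le)
  finally show "real (card (cusp_box Z j)) \<le> 81 * Z ^ 4 + (if 2 ^ j \<le> Z then 27 * Z ^ 3 * 8 ^ j else 0)"
    using X Y by linarith
qed

lemma sum_quarter_powers:
  assumes "finite J"
  shows "(\<Sum>j\<in>J. (1 / 4 :: real) ^ j) \<le> 4 / 3"
proof -
  have "(\<Sum>j\<in>J. (1 / 4 :: real) ^ j) \<le> (\<Sum>j. (1 / 4) ^ j)"
    using assms by (intro sum_le_suminf summable_geometric) auto
  also have "\<dots> = 4 / 3" by (subst suminf_geometric) auto
  finally show ?thesis .
qed

lemma sum_two_powers_upto:
  fixes Z :: real
  assumes "finite J" "0 \<le> Z" "\<And>j. j \<in> J \<Longrightarrow> 2 ^ j \<le> Z"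
  shows "(\<Sum>j\<in>J. (2 :: real) ^ j) \<le> 2 * Z"
proof (cases "J = {}")
  case False
  define n where "n = Max J"
  have n: "n \<in> J" "J \<subseteq> {..n}" using assms(1) False by (auto simp: n_def)
  have "(\<Sum>j\<in>J. (2 :: real) ^ j) \<le> (\<Sum>j\<le>n. 2 ^ j)" by (intro sum_mono2 n) auto
  also have "\<dots> \<le> 2 * 2 ^ n"
    using sum_gp0[of "2 :: real" n] by simp
  also have "\<dots> \<le> 2 * Z" using assms(3)[OF n(1)] by simp
  finally show ?thesis .
qed (use assms in simp)

lemma depressed_trilinear_bound:
  fixes S t c :: real
  assumes t: "0 < t" and p: "fst p \<noteq> 0" and c: "0 \<le> c" "0 \<le> S"
    and b: "\<bar>of_int (fst p)\<bar> / t ^ 3 \<le> c * S" "\<bar>dep2 p\<bar> * t \<le> c * S" "\<bar>dep3 p\<bar> * t ^ 3 \<le> c * S"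
    and r: "\<bar>t * lin (slope p) r\<bar> \<le> a1" "\<bar>of_int (snd r) / t\<bar> \<le> a1"
    and s: "\<bar>t * lin (slope p) s\<bar> \<le> a2" "\<bar>of_int (snd s) / t\<bar> \<le> a2"
    and q: "\<bar>t * lin (slope p) q\<bar> \<le> a3" "\<bar>of_int (snd q) / t\<bar> \<le> a3"
  shows "\<bar>real_of_int (polar p r s q)\<bar> \<le> 5 * (c * S) * (a1 * a2 * a3)"
proof -
  define u where "u = (\<lambda>r. t * lin (slope p) r)"
  define v where "v = (\<lambda>r :: int \<times> int. of_int (snd r) / t :: real)"
  define A0 where "A0 = real_of_int (fst p) / t ^ 3"
  define A2 where "A2 = dep2 p * t"
  define A3 where "A3 = dep3 p * t ^ 3"
  have A: "\<bar>A0\<bar> \<le> c * S" "\<bar>A2\<bar> \<le> c * S" "\<bar>A3\<bar> \<le> c * S"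
    using b t by (simp_all add: A0_def A2_def A3_def abs_mult)
  have lu: "lin (slope p) x = u x / t" for x using t by (simp add: u_def)
  have lv: "real_of_int (snd x) = v x * t" for x using t by (simp add: v_def)
  have eq: "real_of_int (polar p r s q) = A0 * (u r * u s * u q)
      + A2 * (u r * v s * v q) + A2 * (v r * u s * v q) + A2 * (v r * v s * u q)
      + A3 * (v r * v s * v q)"
    unfolding polar_depressed[OF p] lu lv A0_def A2_def A3_def
    using t by (simp add: field_simps power3_eq_cube)
  have ur: "\<bar>u r\<bar> \<le> a1" "\<bar>v r\<bar> \<le> a1" "\<bar>u s\<bar> \<le> a2" "\<bar>v s\<bar> \<le> a2" "\<bar>u q\<bar> \<le> a3" "\<bar>v q\<bar> \<le> a3"
    using r s q by (simp_all add: u_def v_def)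
  have a: "0 \<le> a1" "0 \<le> a2" "0 \<le> a3" using ur by linarith+
  have cs: "0 \<le> c * S" using c by simp
  have T: "\<bar>w * (x * y * z)\<bar> \<le> (c * S) * (a1 * a2 * a3)"
    if "\<bar>w\<bar> \<le> c * S" "\<bar>x\<bar> \<le> a1" "\<bar>y\<bar> \<le> a2" "\<bar>z\<bar> \<le> a3" for w x y z
    unfolding abs_mult by (intro mult_mono that) (use a cs in auto)
  have "\<bar>real_of_int (polar p r s q)\<bar> \<le> 5 * ((c * S) * (a1 * a2 * a3))"
    unfolding eq using T[OF A(1) ur(1,3,5)] T[OF A(2) ur(1,4,6)] T[OF A(2) ur(2,3,6)]
      T[OF A(2) ur(2,4,5)] T[OF A(3) ur(2,4,6)] by linarith
  then show ?thesis by (simp add: mult.assoc)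
qed

text \<open>Double counting of pairs \<open>(p, k)\<close>, where \<open>p\<close> has a reduced basis at level \<open>j\<close> and \<open>k < 4\<^sup>j\<close>
  selects a translate. Each pair gives a form in the box of level \<open>j\<close>, the form and \<open>p\<close> determine
  \<open>k\<close>, and by hypothesis at most \<open>m\<close> points share a form. Dividing the size of the box by
  \<open>4\<^sup>j\<close> leaves \<open>S\<^sup>4 4\<^sup>-\<^sup>j\<close> and, for \<open>2\<^sup>j = O(S)\<close>, \<open>S\<^sup>3 2\<^sup>j\<close>; both sum to \<open>O(S\<^sup>4)\<close>.\<close>

lemma orbit_count:
  fixes P :: "cubic set" and c S t m :: real
  assumes fin: "finite P" and t: "1 \<le> t" and c: "0 \<le> c" and S: "0 \<le> S" and m: "0 \<le> m"
    and P: "\<And>p. p \<in> P \<Longrightarrow> fst p \<noteq> 0 \<and> discr p \<noteq> 0 \<and> \<bar>of_int (fst p)\<bar> / t ^ 3 \<le> c * S \<and>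
      \<bar>dep2 p\<bar> * t \<le> c * S \<and> \<bar>dep3 p\<bar> * t ^ 3 \<le> c * S"
    and mult: "\<And>f j. real (card {p \<in> P. \<exists>r s. det2 r s = 1 \<and> f = act r s p \<and>
       \<bar>of_int (snd r)\<bar> \<le> 2 * t / 2 ^ j \<and> \<bar>of_int (snd s)\<bar> \<le> 5 * t * 2 ^ j}) \<le> m"
  shows "real (card P) \<le> 162 * (625 * c * S) ^ 4 * m"
proof -
  define Z where "Z = 625 * c * S"
  have Z: "0 \<le> Z" using c S by (simp add: Z_def)
  define good where "good = (\<lambda>p r s j. det2 r s = 1 \<and>
    \<bar>t * lin (slope p) r\<bar> \<le> 2 / 2 ^ j \<and> \<bar>of_int (snd r) / t\<bar> \<le> 2 / 2 ^ j \<and>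
    (\<forall>k < 4 ^ j. \<bar>t * lin (slope p) (row_add s (int k) r)\<bar> \<le> 5 * 2 ^ j \<and>
        \<bar>of_int (snd (row_add s (int k) r)) / t\<bar> \<le> 5 * 2 ^ j))"
  have "\<exists>r s j. good p r s j" for p
    using reduced_frame[OF t, of "slope p"] unfolding good_def by metis
  then obtain R T J where RTJ: "\<And>p. good p (R p) (T p) (J p)" by metis
  define \<Psi> where "\<Psi> = (\<lambda>(p, k). act (R p) (row_add (T p) (int k) (R p)) p)"
  have level: "4 ^ j * real (card {p \<in> P. J p = j}) \<le> real (card (cusp_box Z j)) * m" for j
  proof -
    define Pj where "Pj = {p \<in> P. J p = j}"
    define E where "E = Pj \<times> {..<(4 :: nat) ^ j}"
    have finE: "finite E" using fin by (simp add: E_def Pj_def)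
    have inbox: "\<Psi> e \<in> cusp_box Z j" if e: "e \<in> E" for e
    proof -
      obtain p k where pk: "e = (p, k)" "p \<in> P" "J p = j" "k < 4 ^ j"
        using e by (auto simp: E_def Pj_def)
      define r where "r = R p"
      define s where "s = row_add (T p) (int k) (R p)"
      have g: "det2 r s = 1" "\<bar>t * lin (slope p) r\<bar> \<le> 2 / 2 ^ j" "\<bar>of_int (snd r) / t\<bar> \<le> 2 / 2 ^ j"
        "\<bar>t * lin (slope p) s\<bar> \<le> 5 * 2 ^ j" "\<bar>of_int (snd s) / t\<bar> \<le> 5 * 2 ^ j"
        using RTJ[of p] pk unfolding good_def r_def s_def det2_row_add by auto
      have t0: "0 < t" using t by simp
      have pp: "fst p \<noteq> 0" "discr p \<noteq> 0" "\<bar>of_int (fst p)\<bar> / t ^ 3 \<le> c * S"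
        "\<bar>dep2 p\<bar> * t \<le> c * S" "\<bar>dep3 p\<bar> * t ^ 3 \<le> c * S" using P[OF pk(2)] by auto
      note bd = depressed_trilinear_bound[OF t0 pp(1) c S pp(3,4,5)]
      have e8: "(8 :: real) ^ j = 2 ^ j * 2 ^ j * 2 ^ j" by (simp flip: power_mult_distrib)
      define W where "W = c * S"
      have W: "0 \<le> W" "Z = 625 * W" using c S by (simp_all add: W_def Z_def)
      note bd = bd[folded W_def]
      have f0: "\<bar>real_of_int (polar p r r r)\<bar> \<le> Z / 8 ^ j"
        by (rule order_trans[OF bd[OF g(2,3) g(2,3) g(2,3)]])
          (use W in \<open>simp add: e8 divide_right_mono\<close>)
      have f1: "\<bar>real_of_int (polar p r r s)\<bar> \<le> Z / 2 ^ j"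
        by (rule order_trans[OF bd[OF g(2,3) g(2,3) g(4,5)]])
          (use W in \<open>simp add: divide_right_mono\<close>)
      have f2: "\<bar>real_of_int (polar p r s s)\<bar> \<le> Z * 2 ^ j"
        by (rule order_trans[OF bd[OF g(2,3) g(4,5) g(4,5)]])
          (use W in \<open>simp add: mult_right_mono\<close>)
      have f3: "\<bar>real_of_int (polar p s s s)\<bar> \<le> Z * 8 ^ j"
        by (rule order_trans[OF bd[OF g(4,5) g(4,5) g(4,5)]])
          (use W in \<open>simp add: e8 mult_right_mono\<close>)
      \<comment> \<open>Otherwise the form has a double root, contrary to the nonzero discriminant.\<close>
      have "polar p r r r \<noteq> 0 \<or> polar p r r s \<noteq> 0"
      proof (rule ccontr)
        assume "\<not> ?thesis"
        then have "act r s p = (0, 0, polar p r s s, polar p s s s)" by (simp add: act_def)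
        then have "p = act (snd s, - snd r) (- fst s, fst r) (0, 0, polar p r s s, polar p s s s)"
          using act_inverse[OF g(1), of p] by simp
        then have "discr p = 0" by (metis discr_act_double_root)
        with pp(2) show False by simp
      qed
      with f0 f1 f2 f3 have "act r s p \<in> cusp_box Z j" by (simp add: cusp_box_def act_def)
      then show ?thesis by (simp add: \<Psi>_def pk(1) r_def s_def)
    qed
    have fibre: "real (card {e \<in> E. \<Psi> e = f}) \<le> m" for f
    proof -
      let ?F = "{p \<in> P. \<exists>r s. det2 r s = 1 \<and> f = act r s p \<and>
       \<bar>of_int (snd r)\<bar> \<le> 2 * t / 2 ^ j \<and> \<bar>of_int (snd s)\<bar> \<le> 5 * t * 2 ^ j}"
      have inj: "inj_on fst {e \<in> E. \<Psi> e = f}"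
      proof (rule inj_onI)
        fix e e' assume e: "e \<in> {e \<in> E. \<Psi> e = f}" "e' \<in> {e \<in> E. \<Psi> e = f}" "fst e = fst e'"
        obtain p k k' where ee: "e = (p, k)" "e' = (p, k')" using e(3) by (cases e; cases e') auto
        obtain g0 g1 g2 g3 where g: "act (R p) (T p) p = (g0, g1, g2, g3)" by (cases "act (R p) (T p) p")
        have "\<Psi> e = \<Psi> e'" using e by simp
        then have eq: "int k * g0 = int k' * g0" "2 * int k * g1 + (int k)\<^sup>2 * g0 = 2 * int k' * g1 + (int k')\<^sup>2 * g0"
          by (simp_all add: \<Psi>_def ee act_row_add[OF g])
        \<comment> \<open>Then \<open>k\<close> can be read off from the translate, by the second coefficient or the third.\<close>
        have "g0 \<noteq> 0 \<or> g1 \<noteq> 0"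
        proof (rule ccontr)
          assume "\<not> ?thesis"
          then have "\<Psi> (p, k) = (0, 0, g2, g3 + 3 * int k * g2)" by (simp add: \<Psi>_def act_row_add[OF g])
          moreover have "\<Psi> (p, k) \<in> cusp_box Z j" using inbox e(1) ee by blast
          ultimately show False by (simp add: cusp_box_def)
        qed
        then have "k = k'" using eq by auto
        then show "e = e'" using ee by simp
      qed
      have "fst ` {e \<in> E. \<Psi> e = f} \<subseteq> ?F"
      proof (rule image_subsetI)
        fix e assume e: "e \<in> {e \<in> E. \<Psi> e = f}"
        obtain p k where pk: "e = (p, k)" "p \<in> P" "J p = j" "k < 4 ^ j"
          using e by (auto simp: E_def Pj_def)
        define r where "r = R p"
        define s where "s = row_add (T p) (int k) (R p)"
        have g: "det2 r s = 1" "\<bar>of_int (snd r) / t\<bar> \<le> 2 / 2 ^ j" "\<bar>of_int (snd s) / t\<bar> \<le> 5 * 2 ^ j"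
          using RTJ[of p] pk unfolding good_def r_def s_def det2_row_add by auto
        have "f = act r s p" using e by (simp add: \<Psi>_def pk(1) r_def s_def)
        moreover have "\<bar>real_of_int (snd r)\<bar> \<le> 2 * t / 2 ^ j" "\<bar>real_of_int (snd s)\<bar> \<le> 5 * t * 2 ^ j"
          using g(2,3) t by (simp_all add: field_simps)
        ultimately have "p \<in> ?F" using g(1) pk(2) by blast
        then show "fst e \<in> ?F" by (simp add: pk(1))
      qed
      then have "card {e \<in> E. \<Psi> e = f} \<le> card ?F"
        using fin by (intro card_inj_on_le[OF inj]) auto
      then show ?thesis using mult[of f j] by linarith
    qed
    have "real (card E) = real (\<Sum>f\<in>cusp_box Z j. card {e \<in> E. \<Psi> e = f})"
    proof -
      have "card E = (\<Sum>f\<in>\<Psi> ` E. card {e \<in> E. \<Psi> e = f})"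
        using sum.image_gen[OF finE, of "\<lambda>_. 1 :: nat" \<Psi>] by simp
      also have "\<dots> = (\<Sum>f\<in>cusp_box Z j. card {e \<in> E. \<Psi> e = f})"
      proof (rule sum.mono_neutral_left)
        show "\<forall>f\<in>cusp_box Z j - \<Psi> ` E. card {e \<in> E. \<Psi> e = f} = 0"
        proof
          fix f assume "f \<in> cusp_box Z j - \<Psi> ` E"
          then have "{e \<in> E. \<Psi> e = f} = {}" by blast
          then show "card {e \<in> E. \<Psi> e = f} = 0" by (simp only: card.empty)
        qed
      qed (use inbox cusp_box_card(1)[OF Z] in blast)+
      finally show ?thesis by simp
    qed
    also have "\<dots> \<le> (\<Sum>f\<in>cusp_box Z j. m)" unfolding of_nat_sum by (intro sum_mono fibre)
    also have "\<dots> = real (card (cusp_box Z j)) * m" by simp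
    finally show ?thesis by (simp add: E_def Pj_def card_cartesian_product mult.commute)
  qed
  have lev: "real (card {p \<in> P. J p = j}) \<le>
     m * (81 * Z ^ 4 * (1 / 4) ^ j) + m * (if 2 ^ j \<le> Z then 27 * Z ^ 3 * 2 ^ j else 0)" for j
  proof -
    have e8: "(8 :: real) ^ j = 4 ^ j * 2 ^ j" by (simp flip: power_mult_distrib)
    have "4 ^ j * real (card {p \<in> P. J p = j}) \<le> (81 * Z ^ 4 + (if 2 ^ j \<le> Z then 27 * Z ^ 3 * 8 ^ j else 0)) * m"
      by (rule order_trans[OF level]) (intro mult_right_mono cusp_box_card Z m)
    also have "\<dots> = 4 ^ j * (m * (81 * Z ^ 4 * (1 / 4) ^ j) + m * (if 2 ^ j \<le> Z then 27 * Z ^ 3 * 2 ^ j else 0))"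
      by (simp add: e8 power_one_over field_simps)
    finally show ?thesis by (simp add: mult_le_cancel_left_pos)
  qed
  have "card P = (\<Sum>j\<in>J ` P. card {p \<in> P. J p = j})"
    using sum.image_gen[OF fin, of "\<lambda>_. 1 :: nat" J] by simp
  then have "real (card P) = (\<Sum>j\<in>J ` P. real (card {p \<in> P. J p = j}))" by simp
  also have "\<dots> \<le> (\<Sum>j\<in>J ` P. m * (81 * Z ^ 4 * (1 / 4) ^ j) + m * (if 2 ^ j \<le> Z then 27 * Z ^ 3 * 2 ^ j else 0))"
    by (intro sum_mono lev)
  also have "\<dots> = m * (81 * Z ^ 4 * (\<Sum>j\<in>J ` P. (1 / 4) ^ j)) +
      m * (27 * Z ^ 3 * (\<Sum>j\<in>{j \<in> J ` P. 2 ^ j \<le> Z}. 2 ^ j))"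
  proof -
    have "(\<Sum>j\<in>J ` P. (if 2 ^ j \<le> Z then 27 * Z ^ 3 * 2 ^ j else 0)) =
        (\<Sum>j\<in>{j \<in> J ` P. 2 ^ j \<le> Z}. 27 * Z ^ 3 * 2 ^ j)"
      using fin by (intro sum.inter_filter[symmetric]) simp
    then show ?thesis by (simp only: sum.distrib flip: sum_distrib_left)
  qed
  also have "\<dots> \<le> m * (81 * Z ^ 4 * (4 / 3)) + m * (27 * Z ^ 3 * (2 * Z))"
    using fin by (intro add_mono mult_left_mono sum_quarter_powers sum_two_powers_upto Z m) (use Z in auto)
  also have "\<dots> = 162 * Z ^ 4 * m" by (simp add: power4_eq_xxxx power3_eq_cube)
  finally show ?thesis by (simp add: Z_def)
qed

section \<open>Points of one orbit: the trivial bound\<close>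

lemma coprime_if_det2:
  assumes "det2 r s = 1"
  shows "coprime (fst r) (snd r)"
proof (rule coprimeI)
  fix d assume "d dvd fst r" "d dvd snd r"
  then have "d dvd det2 r s" by (simp add: det2_def)
  then show "is_unit d" by (simp add: assms)
qed

text \<open>The first row of the inverse matrix is \<open>(snd s, - snd r)\<close>, and it lies in a box of area
  \<open>O(t\<^sup>2)\<close>. When the short side is below 1 only \<open>(1, 0)\<close> and \<open>(-1, 0)\<close> remain.\<close>

lemma frame_fibre_card:
  assumes t: "1 \<le> t" and c: "0 \<le> c" and P: "\<And>p. p \<in> P \<Longrightarrow> 0 < fst p \<and> \<bar>slope p\<bar> \<le> c"
  shows "real (card {p \<in> P. \<exists>r s. det2 r s = 1 \<and> f = act r s p \<and>
       \<bar>of_int (snd r)\<bar> \<le> 2 * t / 2 ^ j \<and> \<bar>of_int (snd s)\<bar> \<le> 5 * t * 2 ^ j}) \<le> 90 * t\<^sup>2 * (2 * c + 3)"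
    (is "real (card ?F) \<le> _")
proof -
  define R where "R = {r :: int \<times> int. \<bar>real_of_int (fst r)\<bar> \<le> 5 * t * 2 ^ j \<and>
    \<bar>real_of_int (snd r)\<bar> \<le> 2 * t / 2 ^ j \<and> coprime (fst r) (snd r)}"
  have "finite R \<and> real (card R) \<le> 90 * t\<^sup>2"
  proof (cases "1 \<le> 2 * t / 2 ^ j")
    case True
    let ?I = "\<lambda>B. {x :: int. \<bar>real_of_int x\<bar> \<le> B}"
    have sub: "R \<subseteq> ?I (5 * t * 2 ^ j) \<times> ?I (2 * t / 2 ^ j)" by (auto simp: R_def)
    have fin: "finite (?I (5 * t * 2 ^ j) \<times> ?I (2 * t / 2 ^ j))"
      by (intro finite_cartesian_product finite_abs_int)
    have "(1 :: real) \<le> 2 ^ j" by simp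
    then have b: "1 \<le> 5 * t * 2 ^ j" using mult_mono[of 1 "5 * t" 1 "2 ^ j"] t by simp
    have "real (card R) \<le> real (card (?I (5 * t * 2 ^ j))) * real (card (?I (2 * t / 2 ^ j)))"
      using card_mono[OF fin sub] by (simp add: card_cartesian_product flip: of_nat_mult)
    also have "\<dots> \<le> (3 * (5 * t * 2 ^ j)) * (3 * (2 * t / 2 ^ j))"
      by (intro mult_mono card_abs_int' b True) (use t in auto)
    also have "\<dots> = 90 * t\<^sup>2" by (simp add: power2_eq_square)
    finally show ?thesis using finite_subset[OF sub fin] by simp
  next
    case False
    have sub: "R \<subseteq> {(1, 0), (-1, 0)}"
    proof (rule subsetI)
      fix r assume r: "r \<in> R"
      then have "\<bar>real_of_int (snd r)\<bar> \<le> 2 * t / 2 ^ j" by (simp add: R_def)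
      then have "\<bar>real_of_int (snd r)\<bar> < 1" using False by linarith
      then have "snd r = 0" by linarith
      moreover have "\<bar>fst r\<bar> = 1" using r \<open>snd r = 0\<close> by (simp add: R_def)
      ultimately show "r \<in> {(1, 0), (-1, 0)}" by (cases r) auto
    qed
    have "real (card R) \<le> 2" using card_mono[OF _ sub] by simp
    also have "\<dots> \<le> 90 * t\<^sup>2" using one_le_power[OF t, of 2] by linarith
    finally show ?thesis using finite_subset[OF sub] by simp
  qed
  then have R: "finite R" "real (card R) \<le> 90 * t\<^sup>2" by auto
  have "real (card ?F) \<le> real (card R) * (2 * c + 3)"
  proof (rule orbit_fibre_card(2)[OF R(1) c, where f = f])
    fix p assume p: "p \<in> ?F"
    then obtain r s where rs: "det2 r s = 1" "f = act r s p"
      "\<bar>real_of_int (snd r)\<bar> \<le> 2 * t / 2 ^ j" "\<bar>real_of_int (snd s)\<bar> \<le> 5 * t * 2 ^ j" by blast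
    have d: "det2 (snd s, - snd r) (- fst s, fst r) = 1" using rs(1) by (simp add: det2_def mult.commute)
    have "(snd s, - snd r) \<in> R" using rs(3,4) coprime_if_det2[OF d] by (simp add: R_def)
    moreover have "p = act (snd s, - snd r) (- fst s, fst r) f" using act_inverse[OF rs(1)] rs(2) by simp
    ultimately show "0 < fst p \<and> \<bar>slope p\<bar> \<le> c \<and> (\<exists>r\<in>R. \<exists>s. det2 r s = 1 \<and> p = act r s f)"
      using P p d by blast
  qed
  also have "\<dots> \<le> 90 * t\<^sup>2 * (2 * c + 3)" by (intro mult_right_mono R) (use c in auto)
  finally show ?thesis .
qed

text \<open>The scale at which the outer coefficients \<open>Q / t\<^sup>3\<close> and \<open>\<eta> \<delta> t\<^sup>3\<close> are equal. The condition
  \<open>\<delta> \<le> Q \<eta>\<^sup>2\<close> says that the inner coefficient \<open>\<delta> t\<close> does not exceed them.\<close>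

lemma balanced_scale:
  fixes Q \<delta> \<eta> :: real
  assumes "0 < \<delta>" "0 < \<eta>" "\<eta> \<le> 1" "\<delta> \<le> Q * \<eta>\<^sup>2"
  obtains t where "1 \<le> t" "t ^ 6 = Q / (\<eta> * \<delta>)" "\<delta> * t \<le> Q / t ^ 3" "\<eta> * \<delta> * t ^ 3 = Q / t ^ 3"
    "(Q / t ^ 3) ^ 4 = (Q * \<eta> * \<delta>)\<^sup>2"
proof -
  have Q: "0 < Q" using assms by (smt (verit) mult_nonpos_nonneg zero_le_power2)
  have "Q * \<eta>\<^sup>2 \<le> Q * 1" using assms Q by (intro mult_left_mono power_le_one) auto
  then have "\<delta> \<le> Q" using assms by simp
  moreover have "\<eta> * \<delta> \<le> 1 * \<delta>" using assms by (intro mult_right_mono) auto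
  ultimately have "\<eta> * \<delta> \<le> Q" by simp
  then have ge: "1 \<le> Q / (\<eta> * \<delta>)" using assms by simp
  define t where "t = root 6 (Q / (\<eta> * \<delta>))"
  have t6: "t ^ 6 = Q / (\<eta> * \<delta>)" unfolding t_def using ge by (intro real_root_pow_pos2) auto
  have t1: "1 \<le> t" unfolding t_def using ge by simp
  then have t0: "0 < t" by simp
  have Qe: "Q = \<eta> * \<delta> * t ^ 6" using t6 assms by simp
  have e: "\<eta> * \<delta> * t ^ 3 = Q / t ^ 3"
    using t0 unfolding Qe by (simp add: field_simps flip: power_add)
  have "\<delta> * t ^ 4 \<le> Q"
  proof (rule power_le_imp_le_base[where n = 2])
    have "(\<delta> * t ^ 4) ^ 3 = \<delta> * (\<delta>\<^sup>2 * (t ^ 6)\<^sup>2)" by (simp add: power2_eq_square power3_eq_cube eval_nat_numeral)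
    also have "\<delta>\<^sup>2 * (t ^ 6)\<^sup>2 = Q\<^sup>2 / \<eta>\<^sup>2" unfolding t6 using assms by (simp add: power_divide power_mult_distrib)
    also have "\<delta> * (Q\<^sup>2 / \<eta>\<^sup>2) \<le> (Q * \<eta>\<^sup>2) * (Q\<^sup>2 / \<eta>\<^sup>2)" using assms by (intro mult_right_mono) auto
    also have "\<dots> = Q ^ 3" using assms by (simp add: power2_eq_square power3_eq_cube)
    finally show "(\<delta> * t ^ 4) ^ Suc 2 \<le> Q ^ Suc 2" by (simp only: eval_nat_numeral)
  qed (use Q in simp)
  then have d: "\<delta> * t \<le> Q / t ^ 3" using t0 by (simp add: field_simps eval_nat_numeral)
  have "(Q / t ^ 3) ^ 4 = Q ^ 4 / (t ^ 6)\<^sup>2" by (simp add: power_divide flip: power_mult)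
  also have "\<dots> = (Q * \<eta> * \<delta>)\<^sup>2"
    unfolding t6 using assms Q by (simp add: field_simps power2_eq_square power4_eq_xxxx)
  finally show ?thesis using that[OF t1 t6 d e] by simp
qed

lemma region_orbit_count:
  assumes P: "P \<subseteq> region c Q \<delta> \<eta>" and c: "1 \<le> c"
    and par: "0 < \<delta>" "0 < \<eta>" "\<eta> \<le> 1" "\<delta> \<le> Q * \<eta>\<^sup>2" and m: "0 \<le> m"
    and mult: "\<And>t f j. 1 \<le> t \<Longrightarrow> t ^ 6 = Q / (\<eta> * \<delta>) \<Longrightarrow>
      real (card {p \<in> P. \<exists>r s. det2 r s = 1 \<and> f = act r s p \<and>
       \<bar>of_int (snd r)\<bar> \<le> 2 * t / 2 ^ j \<and> \<bar>of_int (snd s)\<bar> \<le> 5 * t * 2 ^ j}) \<le> m"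
  shows "real (card P) \<le> 162 * (625 * c) ^ 4 * (Q * \<eta> * \<delta>)\<^sup>2 * m"
proof -
  obtain t where t: "1 \<le> t" "t ^ 6 = Q / (\<eta> * \<delta>)" "\<delta> * t \<le> Q / t ^ 3" "\<eta> * \<delta> * t ^ 3 = Q / t ^ 3"
    "(Q / t ^ 3) ^ 4 = (Q * \<eta> * \<delta>)\<^sup>2" using balanced_scale[OF par] .
  define S where "S = Q / t ^ 3"
  have S: "0 \<le> S" unfolding S_def t(4)[symmetric] using par t(1) by simp
  have "real (card P) \<le> 162 * (625 * c * S) ^ 4 * m"
  proof (rule orbit_count[OF _ t(1) _ S m _ mult[OF t(1,2)]])
    show "finite P" by (rule finite_subset[OF P finite_region])
    show "0 \<le> c" using c by simp
    fix p assume "p \<in> P"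
    then have p: "Q / 2 < of_int (fst p)" "of_int (fst p) \<le> Q" "\<bar>dep2 p\<bar> \<le> c * \<delta>"
      "\<bar>dep3 p\<bar> \<le> c * \<eta> * \<delta>" "discr p \<noteq> 0" using P by (auto simp: region_def)
    have p0: "0 < real_of_int (fst p)" using p by linarith
    have "\<bar>real_of_int (fst p)\<bar> / t ^ 3 \<le> S"
      unfolding S_def using p(2) p0 t(1) by (intro divide_right_mono) auto
    also have "\<dots> \<le> c * S" using mult_right_mono[OF c S] by simp
    finally have 1: "\<bar>real_of_int (fst p)\<bar> / t ^ 3 \<le> c * S" .
    have "\<bar>dep2 p\<bar> * t \<le> (c * \<delta>) * t" using p(3) t(1) by (intro mult_right_mono) auto
    also have "\<dots> = c * (\<delta> * t)" by simp
    also have "\<dots> \<le> c * S" using t(3) c by (intro mult_left_mono) (auto simp: S_def)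
    finally have 2: "\<bar>dep2 p\<bar> * t \<le> c * S" .
    have "\<bar>dep3 p\<bar> * t ^ 3 \<le> (c * \<eta> * \<delta>) * t ^ 3" using p(4) t(1) by (intro mult_right_mono) auto
    also have "\<dots> = c * S" unfolding S_def t(4)[symmetric] by simp
    finally have 3: "\<bar>dep3 p\<bar> * t ^ 3 \<le> c * S" .
    show "fst p \<noteq> 0 \<and> discr p \<noteq> 0 \<and> \<bar>of_int (fst p)\<bar> / t ^ 3 \<le> c * S \<and>
      \<bar>dep2 p\<bar> * t \<le> c * S \<and> \<bar>dep3 p\<bar> * t ^ 3 \<le> c * S" using 1 2 3 p(5) p0 by auto
  qed
  also have "(625 * c * S) ^ 4 = (625 * c) ^ 4 * (Q * \<eta> * \<delta>)\<^sup>2"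
    unfolding t(5)[symmetric] S_def[symmetric] by (simp only: power_mult_distrib)
  finally show ?thesis by (simp add: mult.assoc)
qed

text \<open>If \<open>\<eta>\<^sup>2\<close> is of order \<open>\<delta> / Q\<close>, then \<open>t\<^sup>6 = Q / (\<eta> \<delta>)\<close> is of order \<open>\<eta>\<^sup>-\<^sup>3\<close>, and the trivial
  bound \<open>t\<^sup>2\<close> on the multiplicity is already \<open>O(1 / \<eta>)\<close>.\<close>

lemma region_count_balanced:
  assumes c: "1 \<le> c" and par: "0 < \<delta>" "0 < \<eta>" "\<eta> \<le> 1" "\<delta> \<le> Q * \<eta>\<^sup>2"
    and K: "1 \<le> K" "Q * \<eta>\<^sup>2 \<le> K * \<delta>"
  shows "real (card (region c Q \<delta> \<eta>)) \<le> 162 * (625 * c) ^ 4 * (90 * K * (2 * c + 3)) * (Q\<^sup>2 * \<delta>\<^sup>2 * \<eta>)"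
proof -
  have "real (card (region c Q \<delta> \<eta>)) \<le> 162 * (625 * c) ^ 4 * (Q * \<eta> * \<delta>)\<^sup>2 * (90 * (K / \<eta>) * (2 * c + 3))"
  proof (rule region_orbit_count[OF subset_refl c par])
    show "0 \<le> 90 * (K / \<eta>) * (2 * c + 3)" using c K par by simp
    fix t :: real and f :: cubic and j :: nat
    assume t: "1 \<le> t" "t ^ 6 = Q / (\<eta> * \<delta>)"
    have "t\<^sup>2 \<le> K / \<eta>"
    proof (rule power_le_imp_le_base[where n = 2])
      have "(t\<^sup>2) ^ 3 = Q / (\<eta> * \<delta>)" unfolding t(2)[symmetric] by simp
      also have "\<dots> \<le> K / \<eta> ^ 3"
        using K(2) par by (simp add: field_simps eval_nat_numeral)
      also have "\<dots> \<le> K ^ 3 / \<eta> ^ 3"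
        using K par power_increasing[of 1 3 K] by (intro divide_right_mono) auto
      finally show "(t\<^sup>2) ^ Suc 2 \<le> (K / \<eta>) ^ Suc 2" by (simp add: power_divide eval_nat_numeral)
    qed (use K par in simp)
    then have "90 * t\<^sup>2 * (2 * c + 3) \<le> 90 * (K / \<eta>) * (2 * c + 3)" using c by (intro mult_right_mono) auto
    moreover have "0 < fst p \<and> \<bar>slope p\<bar> \<le> c" if "p \<in> region c Q \<delta> \<eta>" for p
    proof -
      have "0 < real_of_int (fst p)" using that by (auto simp: region_def)
      then show ?thesis using that by (simp add: region_def)
    qed
    ultimately show "real (card {p \<in> region c Q \<delta> \<eta>. \<exists>r s. det2 r s = 1 \<and> f = act r s p \<and>
       \<bar>of_int (snd r)\<bar> \<le> 2 * t / 2 ^ j \<and> \<bar>of_int (snd s)\<bar> \<le> 5 * t * 2 ^ j}) \<le> 90 * (K / \<eta>) * (2 * c + 3)"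
      using frame_fibre_card[OF t(1), of c "region c Q \<delta> \<eta>" f j] c by fastforce
  qed
  also have "\<dots> = 162 * (625 * c) ^ 4 * (90 * K * (2 * c + 3)) * (Q\<^sup>2 * \<delta>\<^sup>2 * \<eta>)"
    using par by (simp add: power2_eq_square field_simps)
  finally show ?thesis .
qed

section \<open>Points of one orbit: the bound from the Hessian\<close>

text \<open>A cubic form is a combination of the cubes of the linear factors of its Hessian, if these are
  distinct. The factors are normalised as \<open>u + \<rho> v\<close> and \<open>v + \<sigma> u\<close> with \<open>\<kappa>\<close> in front; comparing
  the coefficients of \<open>u v\<close> gives the quadratic equation for \<open>\<kappa>\<close>. In terms of \<open>\<kappa>\<close> the coefficients
  of the two cubes involve no division by \<open>e2\<close>, which may vanish.\<close>

lemma hessian_diagonalisation: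
  fixes p0 e2 e3 \<kappa> :: real
  assumes p0: "p0 \<noteq> 0" and \<kappa>: "\<kappa> \<noteq> 0" "\<kappa>\<^sup>2 = p0 * e3 * \<kappa> + p0 * e2 ^ 3"
  defines "\<rho> \<equiv> - (e2\<^sup>2 / \<kappa>)" and "\<sigma> \<equiv> p0 * e2 / \<kappa>"
  shows "p0 * e2 * u\<^sup>2 + p0 * e3 * u * v - e2\<^sup>2 * v\<^sup>2 = \<kappa> * ((u + \<rho> * v) * (v + \<sigma> * u))"
    and "(1 - \<rho> * \<sigma>) * (p0 * u ^ 3 + 3 * e2 * u * v\<^sup>2 + e3 * v ^ 3) =
      p0 * (u + \<rho> * v) ^ 3 + \<kappa> / p0 * (v + \<sigma> * u) ^ 3"
proof -
  define w where "w = inverse \<kappa>"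
  have w: "\<kappa> * w = 1" using \<kappa> by (simp add: w_def)
  define q where "q = inverse p0"
  have q: "p0 * q = 1" using p0 by (simp add: q_def)
  have r: "\<rho> = - e2\<^sup>2 * w" "\<sigma> = p0 * e2 * w" "\<kappa> / p0 = \<kappa> * q"
    by (simp_all add: \<rho>_def \<sigma>_def w_def q_def divide_inverse)
  have e3: "e3 = \<kappa> * q - e2 ^ 3 * w"
    using \<kappa>(2) w q by algebra
  show "p0 * e2 * u\<^sup>2 + p0 * e3 * u * v - e2\<^sup>2 * v\<^sup>2 = \<kappa> * ((u + \<rho> * v) * (v + \<sigma> * u))"
    unfolding r e3 using w q by algebra
  show "(1 - \<rho> * \<sigma>) * (p0 * u ^ 3 + 3 * e2 * u * v\<^sup>2 + e3 * v ^ 3) =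
      p0 * (u + \<rho> * v) ^ 3 + \<kappa> / p0 * (v + \<sigma> * u) ^ 3"
    unfolding r e3 using w q by algebra
qed

text \<open>The root of the larger absolute value, so that \<open>\<kappa>\<close> stays comparable with \<open>E\<close>.\<close>

lemma hessian_root:
  fixes E F :: real
  assumes "E \<noteq> 0" "\<bar>4 * F\<bar> \<le> E\<^sup>2 / 4"
  obtains \<kappa> where "\<kappa>\<^sup>2 = E * \<kappa> + F" "\<bar>E\<bar> / 2 \<le> \<bar>\<kappa>\<bar>" "\<bar>\<kappa>\<bar> \<le> 2 * \<bar>E\<bar>" "\<bar>F\<bar> \<le> \<kappa>\<^sup>2 / 2"
proof -
  have E2: "0 < E\<^sup>2" using assms(1) by simp
  define s where "s = sqrt (E\<^sup>2 + 4 * F)"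
  have pos: "0 \<le> E\<^sup>2 + 4 * F" using assms(2) E2 by linarith
  then have s: "s\<^sup>2 = E\<^sup>2 + 4 * F" "0 \<le> s" by (simp_all add: s_def)
  have "s \<le> 2 * \<bar>E\<bar>" by (rule power2_le_imp_le) (use s(1) assms(2) E2 in \<open>auto simp: power_mult_distrib\<close>)
  \<comment> \<open>The sign avoids cancellation between \<open>E\<close> and the square root.\<close>
  define \<kappa> where "\<kappa> = (if 0 < E then (E + s) / 2 else (E - s) / 2)"
  have "2 * \<kappa> - E = (if 0 < E then s else - s)" by (simp add: \<kappa>_def field_simps)
  then have "(2 * \<kappa> - E)\<^sup>2 = s\<^sup>2" by simp
  then have k: "\<kappa>\<^sup>2 = E * \<kappa> + F" unfolding s(1) by (simp add: power2_eq_square algebra_simps)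
  have l: "\<bar>E\<bar> / 2 \<le> \<bar>\<kappa>\<bar>" "\<bar>\<kappa>\<bar> \<le> 2 * \<bar>E\<bar>"
    using s(2) \<open>s \<le> 2 * \<bar>E\<bar>\<close> by (auto simp: \<kappa>_def)
  have "(\<bar>E\<bar> / 2)\<^sup>2 \<le> \<bar>\<kappa>\<bar>\<^sup>2" by (intro power_mono l) simp
  then have "E\<^sup>2 / 4 \<le> \<kappa>\<^sup>2" by (simp add: power_divide)
  then have "\<bar>F\<bar> \<le> \<kappa>\<^sup>2 / 2" using assms(2) by linarith
  with k l show ?thesis by (rule that)
qed

text \<open>The Hessian bounds \<open>\<bar>U V\<bar>\<close> by \<open>8 / \<eta>\<close>, a region with long hyperbolic arms. Since the form
  takes a value of size \<open>Q\<close>, one of its two cubes has size \<open>Q\<close>. This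
  makes \<open>U\<close> of order 1 or \<open>V\<close> of order \<open>b\<close>, that is, it selects the two ends of the arms; the other
  coordinate is then bounded by the product. The constant 8192 ensures that at the first end the
  cube of \<open>V\<close> contributes at most \<open>Q\<close>, so that \<open>U\<close> is bounded above as well.\<close>

lemma two_parallelograms:
  fixes p0 \<kappa> Q \<delta> \<eta> c \<theta> f h U V :: real
  assumes par: "0 < \<delta>" "0 < \<eta>" "\<eta> \<le> 1" "1 \<le> c" and K: "8192 * c * \<delta> \<le> Q * \<eta>\<^sup>2"
    and p0: "Q / 2 < p0" "p0 \<le> Q" and \<kappa>: "Q * c * \<eta> * \<delta> / 8 \<le> \<bar>\<kappa>\<bar>" "\<bar>\<kappa>\<bar> / p0 \<le> 2 * c * \<eta> * \<delta>"
    and \<theta>: "\<bar>\<theta>\<bar> \<le> 1 / 2"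
    and f: "Q / 2 < f" "f \<le> Q" "(1 - \<theta>) * f = p0 * U ^ 3 + \<kappa> / p0 * V ^ 3"
    and h: "\<bar>h\<bar> \<le> c * Q * \<delta>" "h = \<kappa> * (U * V)"
  defines "b \<equiv> root 3 (2 * Q / (\<bar>\<kappa>\<bar> / p0))"
  shows "\<bar>U\<bar> \<le> 2 \<and> \<bar>V\<bar> \<le> 16 / \<eta> \<or> \<bar>U\<bar> \<le> 24 / (\<eta> * b) \<and> \<bar>V\<bar> \<le> b"
proof -
  have Q: "0 < Q" using p0 by linarith
  have p0': "0 < p0" using p0 Q by linarith
  define \<beta> where "\<beta> = \<bar>\<kappa>\<bar> / p0"
  have "0 < Q * c * \<eta> * \<delta> / 8" using Q par by simp
  then have k0: "0 < \<bar>\<kappa>\<bar>" using \<kappa>(1) by linarith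
  then have b0: "0 < \<beta>" using p0' by (simp add: \<beta>_def)
  have "(Q * c * \<eta> * \<delta> / 8) * \<bar>U * V\<bar> \<le> \<bar>\<kappa>\<bar> * \<bar>U * V\<bar>" by (intro mult_right_mono \<kappa>) simp
  also have "\<dots> \<le> c * Q * \<delta>" using h by (simp add: abs_mult)
  also have "\<dots> = (Q * c * \<eta> * \<delta> / 8) * (8 / \<eta>)" using par by simp
  finally have UV: "\<bar>U\<bar> * \<bar>V\<bar> \<le> 8 / \<eta>"
    using \<open>0 < Q * c * \<eta> * \<delta> / 8\<close> by (simp only: mult_le_cancel_left_pos abs_mult)
  have g: "Q / 4 \<le> \<bar>p0 * U ^ 3 + \<kappa> / p0 * V ^ 3\<bar>" "\<bar>p0 * U ^ 3 + \<kappa> / p0 * V ^ 3\<bar> \<le> 3 / 2 * Q"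
  proof -
    have "(1 / 2) * (Q / 2) \<le> (1 - \<theta>) * f" using \<theta> f Q by (intro mult_mono) auto
    moreover have "(1 - \<theta>) * f \<le> (3 / 2) * Q" using \<theta> f Q by (intro mult_mono) auto
    ultimately show "Q / 4 \<le> \<bar>p0 * U ^ 3 + \<kappa> / p0 * V ^ 3\<bar>"
      "\<bar>p0 * U ^ 3 + \<kappa> / p0 * V ^ 3\<bar> \<le> 3 / 2 * Q" unfolding f(3)[symmetric] using Q by auto
  qed
  have aU: "\<bar>p0 * U ^ 3\<bar> = p0 * \<bar>U\<bar> ^ 3" using p0' by (simp add: abs_mult power_abs)
  have aV: "\<bar>\<kappa> / p0 * V ^ 3\<bar> = \<beta> * \<bar>V\<bar> ^ 3" using p0' by (simp add: abs_mult power_abs \<beta>_def)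
  show ?thesis
  proof (cases "Q / 8 \<le> p0 * \<bar>U\<bar> ^ 3")
    case True
    also have "p0 * \<bar>U\<bar> ^ 3 \<le> Q * \<bar>U\<bar> ^ 3" using p0 by (intro mult_right_mono) auto
    finally have "(1 / 2) ^ 3 \<le> \<bar>U\<bar> ^ 3" using Q by (simp add: power_divide)
    then have U: "1 / 2 \<le> \<bar>U\<bar>" using power_mono_iff[of "1 / 2" "\<bar>U\<bar>" 3] by simp
    have "(1 / 2) * \<bar>V\<bar> \<le> \<bar>U\<bar> * \<bar>V\<bar>" by (intro mult_right_mono U) simp
    then have V: "\<bar>V\<bar> \<le> 16 / \<eta>" using UV by simp
    have "\<beta> * \<bar>V\<bar> ^ 3 \<le> (2 * c * \<eta> * \<delta>) * (16 / \<eta>) ^ 3"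
      using \<kappa>(2) par by (intro mult_mono power_mono V) (auto simp: \<beta>_def)
    also have "\<dots> = 8192 * c * \<delta> / \<eta>\<^sup>2" using par by (simp add: field_simps eval_nat_numeral)
    also have "\<dots> \<le> Q" using K par by (simp add: field_simps)
    finally have "\<bar>\<kappa> / p0 * V ^ 3\<bar> \<le> Q" unfolding aV .
    then have "p0 * \<bar>U\<bar> ^ 3 \<le> 5 / 2 * Q" unfolding aU[symmetric] using g by linarith
    moreover have "Q / 2 * \<bar>U\<bar> ^ 3 \<le> p0 * \<bar>U\<bar> ^ 3" using p0 by (intro mult_right_mono) auto
    ultimately have "Q / 2 * \<bar>U\<bar> ^ 3 \<le> Q / 2 * 5" by linarith
    then have "\<bar>U\<bar> ^ 3 \<le> 5" using Q by (simp only: mult_le_cancel_left_pos half_gt_zero)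
    then have "\<bar>U\<bar> ^ 3 \<le> 2 ^ 3" by simp
    then have "\<bar>U\<bar> \<le> 2" using power_mono_iff[of "\<bar>U\<bar>" 2 3] by simp
    with V show ?thesis by simp
  next
    case False
    then have V: "Q / 8 \<le> \<beta> * \<bar>V\<bar> ^ 3" "\<beta> * \<bar>V\<bar> ^ 3 \<le> 2 * Q"
      unfolding aU[symmetric] aV[symmetric] using g by linarith+
    have bp: "0 < b" unfolding b_def \<beta>_def[symmetric] using Q b0 by simp
    have b3: "b ^ 3 = 2 * Q / \<beta>" unfolding b_def \<beta>_def[symmetric] using Q b0 by simp
    have "\<bar>V\<bar> ^ 3 \<le> b ^ 3" unfolding b3 using V b0 by (simp add: field_simps)
    then have Vb: "\<bar>V\<bar> \<le> b" using bp by (simp add: power_mono_iff)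
    have "b ^ 3 / 16 \<le> \<bar>V\<bar> ^ 3" unfolding b3 using V b0 by (simp add: field_simps)
    moreover have "(b / 3) ^ 3 \<le> b ^ 3 / 16" using bp by (simp add: power_divide)
    ultimately have "(b / 3) ^ 3 \<le> \<bar>V\<bar> ^ 3" by linarith
    then have Vl: "b / 3 \<le> \<bar>V\<bar>" using bp by (simp add: power_mono_iff)
    have "\<bar>U\<bar> * (b / 3) \<le> \<bar>U\<bar> * \<bar>V\<bar>" by (intro mult_left_mono Vl) simp
    then have "\<bar>U\<bar> * (b / 3) \<le> 8 / \<eta>" using UV by linarith
    then have "\<bar>U\<bar> \<le> 24 / (\<eta> * b)" using bp par by (simp add: field_simps)
    with Vb show ?thesis by simp
  qed
qed

text \<open>A point of the orbit with first row \<open>r\<close> has leading coefficient equal to the form at \<open>r\<close>, and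
  its leading coefficient times \<open>dep2\<close> equals the Hessian at \<open>r\<close>. So membership in the region gives
  the two bounds that confine \<open>r\<close> to the parallelograms.\<close>

lemma region_orbit_card:
  assumes p: "p \<in> region c Q \<delta> \<eta>" "c * \<eta> * \<delta> / 2 < \<bar>dep3 p\<bar>"
    and par: "0 < \<delta>" "0 < \<eta>" "\<eta> \<le> 1" "1 \<le> c" and K: "8192 * c * \<delta> \<le> Q * \<eta>\<^sup>2"
  shows "real (card {p' \<in> region c Q \<delta> \<eta>. \<exists>r s. det2 r s = 1 \<and> p' = act r s p}) \<le> 920 / \<eta> * (2 * c + 3)"
    (is "real (card ?F) \<le> _")
proof -
  define p0 where "p0 = real_of_int (fst p)"
  have h: "Q / 2 < p0" "p0 \<le> Q" "\<bar>dep2 p\<bar> \<le> c * \<delta>" "\<bar>dep3 p\<bar> \<le> c * \<eta> * \<delta>"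
    using p(1) by (simp_all add: region_def p0_def)
  have Q: "0 < Q" and p0: "0 < p0" using h by linarith+
  have pn: "fst p \<noteq> 0" using p0 by (auto simp: p0_def)
  have cd: "0 < c * \<eta> * \<delta>" using par by simp
  define E where "E = p0 * dep3 p"
  define F where "F = p0 * dep2 p ^ 3"
  have E: "Q * c * \<eta> * \<delta> / 4 \<le> \<bar>E\<bar>"
  proof -
    have "(Q / 2) * (c * \<eta> * \<delta> / 2) \<le> p0 * \<bar>dep3 p\<bar>" using h p(2) Q cd by (intro mult_mono) auto
    then show ?thesis using p0 by (simp add: E_def abs_mult mult.assoc)
  qed
  have "0 < Q * c * \<eta> * \<delta> / 4" using Q par by simp
  then have E0: "E \<noteq> 0" using E by auto
  have F: "\<bar>4 * F\<bar> \<le> E\<^sup>2 / 4"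
  proof -
    have "\<bar>4 * F\<bar> = 4 * (p0 * \<bar>dep2 p\<bar> ^ 3)" using p0 by (simp add: F_def abs_mult power_abs)
    also have "\<dots> \<le> 4 * (Q * (c * \<delta>) ^ 3)" using h p0 par by (intro mult_left_mono mult_mono power_mono) auto
    also have "\<dots> = 4 * (Q * c\<^sup>2 * \<delta>\<^sup>2) * (c * \<delta>)" by (simp add: power2_eq_square power3_eq_cube)
    also have "\<dots> \<le> 4 * (Q * c\<^sup>2 * \<delta>\<^sup>2) * (Q * \<eta>\<^sup>2 / 8192)" using K Q by (intro mult_left_mono) auto
    also have "\<dots> = (Q * c * \<eta> * \<delta> / 4)\<^sup>2 / 128" by (simp add: power2_eq_square)
    also have "\<dots> \<le> (Q * c * \<eta> * \<delta> / 4)\<^sup>2 / 4" by (intro divide_left_mono) auto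
    also have "\<dots> \<le> \<bar>E\<bar>\<^sup>2 / 4" using \<open>0 < Q * c * \<eta> * \<delta> / 4\<close> by (intro divide_right_mono power_mono E) auto
    finally show ?thesis by simp
  qed
  obtain \<kappa> where \<kappa>: "\<kappa>\<^sup>2 = E * \<kappa> + F" "\<bar>E\<bar> / 2 \<le> \<bar>\<kappa>\<bar>" "\<bar>\<kappa>\<bar> \<le> 2 * \<bar>E\<bar>" "\<bar>F\<bar> \<le> \<kappa>\<^sup>2 / 2"
    using hessian_root[OF E0 F] .
  have kn: "\<kappa> \<noteq> 0" using \<kappa>(2) E0 by auto
  have kQ: "Q * c * \<eta> * \<delta> / 8 \<le> \<bar>\<kappa>\<bar>" using \<kappa>(2) E by linarith
  have kb: "\<bar>\<kappa>\<bar> / p0 \<le> 2 * c * \<eta> * \<delta>"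
  proof -
    have "\<bar>\<kappa>\<bar> \<le> 2 * (p0 * \<bar>dep3 p\<bar>)" using \<kappa>(3) p0 by (simp add: E_def abs_mult)
    also have "\<dots> \<le> 2 * (p0 * (c * \<eta> * \<delta>))" using h p0 by (intro mult_left_mono) auto
    finally show ?thesis using p0 by (simp add: field_simps)
  qed
  define \<rho> where "\<rho> = - ((dep2 p)\<^sup>2 / \<kappa>)"
  define \<sigma> where "\<sigma> = p0 * dep2 p / \<kappa>"
  have "\<rho> * \<sigma> = - (F / \<kappa>\<^sup>2)" by (simp add: \<rho>_def \<sigma>_def F_def power2_eq_square power3_eq_cube)
  then have "\<bar>\<rho> * \<sigma>\<bar> = \<bar>F\<bar> / \<kappa>\<^sup>2" by (simp only: abs_minus_cancel abs_divide abs_power2)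
  also have "\<dots> \<le> \<kappa>\<^sup>2 / 2 / \<kappa>\<^sup>2" by (intro divide_right_mono \<kappa>) simp
  finally have \<theta>: "\<bar>\<rho> * \<sigma>\<bar> \<le> 1 / 2" using kn by simp
  have kE: "\<kappa>\<^sup>2 = p0 * dep3 p * \<kappa> + p0 * dep2 p ^ 3" using \<kappa>(1) by (simp add: E_def F_def)
  define u where "u = lin (slope p)"
  define v where "v = (\<lambda>r :: int \<times> int. real_of_int (snd r))"
  define U where "U = (\<lambda>r. u r + \<rho> * v r)"
  define V where "V = (\<lambda>r. v r + \<sigma> * u r)"
  define b where "b = root 3 (2 * Q / (\<bar>\<kappa>\<bar> / p0))"
  have b: "0 < b" unfolding b_def using Q p0 kn by simp
  have Um: "U (- fst r, - snd r) = - U r" and Vm: "V (- fst r, - snd r) = - V r" for r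
    by (simp_all add: U_def V_def u_def v_def lin_def algebra_simps)
  have det: "\<bar>of_int (det2 r r')\<bar> / 2 \<le> \<bar>U r * V r' - U r' * V r\<bar>" for r r'
  proof -
    have "U r * V r' - U r' * V r = (1 - \<rho> * \<sigma>) * (u r * v r' - v r * u r')"
      by (simp add: U_def V_def algebra_simps)
    also have "u r * v r' - v r * u r' = of_int (det2 r r')" by (simp add: u_def v_def det2_lin)
    finally have "\<bar>U r * V r' - U r' * V r\<bar> = \<bar>1 - \<rho> * \<sigma>\<bar> * \<bar>of_int (det2 r r')\<bar>" by (simp only: abs_mult)
    moreover have "(1 / 2) * \<bar>real_of_int (det2 r r')\<bar> \<le> \<bar>1 - \<rho> * \<sigma>\<bar> * \<bar>of_int (det2 r r')\<bar>"
      by (rule mult_right_mono) (use \<theta> in linarith, simp)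
    ultimately show ?thesis by simp
  qed
  define R1 where "R1 = {r. coprime (fst r) (snd r) \<and> \<bar>U r\<bar> \<le> 2 \<and> \<bar>V r\<bar> \<le> 16 / \<eta>}"
  define R2 where "R2 = {r. coprime (fst r) (snd r) \<and> \<bar>U r\<bar> \<le> 24 / (\<eta> * b) \<and> \<bar>V r\<bar> \<le> b}"
  have R1: "finite R1" "real (card R1) \<le> 16 * 2 * (16 / \<eta>) + 12"
    unfolding R1_def by (rule primitive_in_parallelogram[OF Um Vm det]; use par in simp)+
  have R2: "finite R2" "real (card R2) \<le> 16 * (24 / (\<eta> * b)) * b + 12"
    unfolding R2_def by (rule primitive_in_parallelogram[OF Um Vm det]; use par b in simp)+
  have "real (card (R1 \<union> R2)) \<le> real (card R1) + real (card R2)"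
    using card_Un_le[of R1 R2] by linarith
  also have "\<dots> \<le> 896 / \<eta> + 24" using R1(2) R2(2) b by simp
  also have "\<dots> \<le> 920 / \<eta>" using par by (simp add: field_simps)
  finally have R: "real (card (R1 \<union> R2)) \<le> 920 / \<eta>" .
  have "real (card ?F) \<le> real (card (R1 \<union> R2)) * (2 * c + 3)"
  proof (rule orbit_fibre_card(2)[where f = p])
    show "finite (R1 \<union> R2)" using R1 R2 by simp
    show "0 \<le> c" using par by simp
    fix p' assume p': "p' \<in> ?F"
    then obtain r s where rs: "det2 r s = 1" "p' = act r s p" by blast
    obtain f0 f1 f2 f3 where f: "p' = (f0, f1, f2, f3)" by (cases p')
    have q: "Q / 2 < of_int f0" "of_int f0 \<le> Q" "\<bar>slope p'\<bar> \<le> c" "\<bar>dep2 p'\<bar> \<le> c * \<delta>"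
      using p' by (auto simp: region_def f)
    have f0: "0 < f0" using q Q by (smt (verit) of_int_0_less_iff field_sum_of_halves)
    have "f0 = polar p r r r" using rs(2) f by (simp add: act_def)
    then have fr: "real_of_int f0 = p0 * u r ^ 3 + 3 * dep2 p * u r * (v r)\<^sup>2 + dep3 p * v r ^ 3"
      using polar_depressed[OF pn, of r r r]
      by (simp add: p0_def u_def v_def power2_eq_square power3_eq_cube)
    have "f0 * f2 - f1\<^sup>2 = hess p r" using hess_act[of r s p f0 f1 f2 f3] rs f by simp
    then have "real_of_int f0 * dep2 p' = real_of_int (hess p r)"
      using dep2_times_lead[of f0 f1 f2 f3] f0 f by simp
    then have hr: "real_of_int f0 * dep2 p' = p0 * dep2 p * (u r)\<^sup>2 + p0 * dep3 p * u r * v r - (dep2 p)\<^sup>2 * (v r)\<^sup>2"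
      using hess_depressed[OF pn, of r] by (simp add: p0_def u_def v_def)
    have hb: "\<bar>real_of_int f0 * dep2 p'\<bar> \<le> c * Q * \<delta>"
    proof -
      have "\<bar>real_of_int f0\<bar> * \<bar>dep2 p'\<bar> \<le> Q * (c * \<delta>)" using q f0 by (intro mult_mono) auto
      then show ?thesis by (simp add: abs_mult mult_ac)
    qed
    note diag = hessian_diagonalisation[OF less_imp_neq[OF p0, symmetric] kn kE, folded \<rho>_def \<sigma>_def]
    have "\<bar>U r\<bar> \<le> 2 \<and> \<bar>V r\<bar> \<le> 16 / \<eta> \<or> \<bar>U r\<bar> \<le> 24 / (\<eta> * b) \<and> \<bar>V r\<bar> \<le> b"
      unfolding b_def
    proof (rule two_parallelograms[OF par K h(1,2) kQ kb \<theta> q(1,2) _ hb])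
      show "(1 - \<rho> * \<sigma>) * real_of_int f0 = p0 * U r ^ 3 + \<kappa> / p0 * V r ^ 3"
        unfolding fr U_def V_def by (rule diag(2))
      show "real_of_int f0 * dep2 p' = \<kappa> * (U r * V r)"
        unfolding hr U_def V_def by (rule diag(1))
    qed
    then have "r \<in> R1 \<union> R2" using coprime_if_det2[OF rs(1)] by (auto simp: R1_def R2_def)
    then show "0 < fst p' \<and> \<bar>slope p'\<bar> \<le> c \<and> (\<exists>r\<in>R1 \<union> R2. \<exists>s. det2 r s = 1 \<and> p' = act r s p)"
    proof (intro conjI bexI exI)
      show "0 < fst p'" using f0 f by simp
      show "\<bar>slope p'\<bar> \<le> c" by (rule q(3))
    qed (use rs in auto)
  qed
  also have "\<dots> \<le> 920 / \<eta> * (2 * c + 3)" by (intro mult_right_mono R) (use par in auto)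
  finally show ?thesis .
qed

section \<open>Summation and conclusion\<close>

text \<open>Points sharing a form lie in one orbit, so \<open>region_orbit_card\<close> bounds the multiplicity in the
  double count.\<close>

lemma region_count_top:
  assumes c: "1 \<le> c" and par: "0 < \<delta>" "0 < \<eta>" "\<eta> \<le> 1" and K: "8192 * c * \<delta> \<le> Q * \<eta>\<^sup>2"
  shows "real (card {p \<in> region c Q \<delta> \<eta>. c * \<eta> * \<delta> / 2 < \<bar>dep3 p\<bar>}) \<le>
     162 * (625 * c) ^ 4 * (920 * (2 * c + 3)) * (Q\<^sup>2 * \<delta>\<^sup>2 * \<eta>)"
proof -
  let ?P = "{p \<in> region c Q \<delta> \<eta>. c * \<eta> * \<delta> / 2 < \<bar>dep3 p\<bar>}"
  have "\<delta> \<le> 8192 * c * \<delta>" using c par mult_right_mono[of 1 "8192 * c" \<delta>] by simp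
  then have d: "\<delta> \<le> Q * \<eta>\<^sup>2" using K by linarith
  have "real (card ?P) \<le> 162 * (625 * c) ^ 4 * (Q * \<eta> * \<delta>)\<^sup>2 * (920 / \<eta> * (2 * c + 3))"
  proof (rule region_orbit_count[OF _ c par d])
    show "?P \<subseteq> region c Q \<delta> \<eta>" by blast
    show nn: "0 \<le> 920 / \<eta> * (2 * c + 3)" using c par by simp
    fix t :: real and f :: cubic and j :: nat
    let ?F = "{p \<in> ?P. \<exists>r s. det2 r s = 1 \<and> f = act r s p \<and>
       \<bar>of_int (snd r)\<bar> \<le> 2 * t / 2 ^ j \<and> \<bar>of_int (snd s)\<bar> \<le> 5 * t * 2 ^ j}"
    show "real (card ?F) \<le> 920 / \<eta> * (2 * c + 3)"
    proof (cases "?F = {}")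
      case False
      then obtain q where q: "q \<in> ?F" by blast
      then obtain r' s' where q': "det2 r' s' = 1" "f = act r' s' q" by blast
      have "?F \<subseteq> {p' \<in> region c Q \<delta> \<eta>. \<exists>r s. det2 r s = 1 \<and> p' = act r s q}"
      proof (rule subsetI)
        fix p assume p: "p \<in> ?F"
        then obtain r s where rs: "det2 r s = 1" "f = act r s p" by blast
        have "p = act (snd s, - snd r) (- fst s, fst r) (act r' s' q)"
          using act_inverse[OF rs(1), of p] rs(2) q'(2) by simp
        moreover have "det2 (snd s * fst r' + - snd r * fst s', snd s * snd r' + - snd r * snd s')
           (- fst s * fst r' + fst r * fst s', - fst s * snd r' + fst r * snd s') = det2 r s * det2 r' s'"
          by (simp add: det2_def algebra_simps)
        ultimately have "\<exists>r s. det2 r s = 1 \<and> p = act r s q"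
          unfolding act_act using rs(1) q'(1) by (metis mult_1)
        then show "p \<in> {p' \<in> region c Q \<delta> \<eta>. \<exists>r s. det2 r s = 1 \<and> p' = act r s q}" using p by blast
      qed
      moreover have "finite {p' \<in> region c Q \<delta> \<eta>. \<exists>r s. det2 r s = 1 \<and> p' = act r s q}"
        by (rule finite_subset[OF _ finite_region]) blast
      ultimately have "card ?F \<le> card {p' \<in> region c Q \<delta> \<eta>. \<exists>r s. det2 r s = 1 \<and> p' = act r s q}"
        by (intro card_mono)
      also have "real \<dots> \<le> 920 / \<eta> * (2 * c + 3)"
        by (rule region_orbit_card) (use q par c K in blast)+
      finally show ?thesis by simp
    qed (use nn in \<open>simp only: card.empty of_nat_0\<close>)
  qed
  also have "\<dots> = 162 * (625 * c) ^ 4 * (920 * (2 * c + 3)) * (Q\<^sup>2 * \<delta>\<^sup>2 * \<eta>)"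
    using par by (simp add: power2_eq_square field_simps)
  finally show ?thesis .
qed

text \<open>Halving \<open>\<eta>\<close> until \<open>\<eta>\<^sup>2\<close> is of order \<open>\<delta> / Q\<close>; each step costs \<open>O(Q\<^sup>2 \<delta>\<^sup>2 \<eta>)\<close>, a geometric
  series dominated by its first term.\<close>

lemma region_count:
  assumes c: "1 \<le> c"
  obtains C :: real where "0 < C" "\<And>Q \<delta> \<eta> :: real. 0 < \<delta> \<Longrightarrow> 0 < \<eta> \<Longrightarrow> \<eta> \<le> 1 \<Longrightarrow> \<delta> \<le> Q * \<eta>\<^sup>2 \<Longrightarrow>
    real (card (region c Q \<delta> \<eta>)) \<le> C * (Q\<^sup>2 * \<delta>\<^sup>2 * \<eta>)"
proof -
  \<comment> \<open>With this \<open>K\<close>, failure of the stopping condition at \<open>\<eta>\<close> leaves \<open>\<eta> / 2\<close> admissible.\<close>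
  define K where "K = 4 * (8192 * c)"
  have K: "1 \<le> K" using c by (simp add: K_def)
  define A where "A = 162 * (625 * c) ^ 4 * (90 * K * (2 * c + 3))"
  define B where "B = 162 * (625 * c) ^ 4 * (920 * (2 * c + 3))"
  have AB: "0 < A" "0 < B" using c K by (auto simp: A_def B_def)
  have base: "real (card (region c Q \<delta> \<eta>)) \<le> (2 * (A + B)) * (Q\<^sup>2 * \<delta>\<^sup>2 * \<eta>)"
    if "0 < \<delta>" "0 < \<eta>" "\<eta> \<le> 1" "\<delta> \<le> Q * \<eta>\<^sup>2" "Q * \<eta>\<^sup>2 \<le> K * \<delta>" for Q \<delta> \<eta>
  proof -
    have "real (card (region c Q \<delta> \<eta>)) \<le> A * (Q\<^sup>2 * \<delta>\<^sup>2 * \<eta>)"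
      unfolding A_def by (rule region_count_balanced[OF c that(1-4) K that(5)])
    also have "\<dots> \<le> (2 * (A + B)) * (Q\<^sup>2 * \<delta>\<^sup>2 * \<eta>)" using AB that by (intro mult_right_mono) auto
    finally show ?thesis .
  qed
  have "real (card (region c Q \<delta> \<eta>)) \<le> (2 * (A + B)) * (Q\<^sup>2 * \<delta>\<^sup>2 * \<eta>)"
    if par: "0 < \<delta>" "0 < \<eta>" "\<eta> \<le> 1" "\<delta> \<le> Q * \<eta>\<^sup>2" and n: "Q * \<eta>\<^sup>2 \<le> 4 ^ n * (K * \<delta>)" for Q \<delta> \<eta> n
    using that
  proof (induction n arbitrary: \<eta>)
    case 0
    then show ?case using base by simp
  next
    case (Suc n)
    show ?case
    proof (cases "Q * \<eta>\<^sup>2 \<le> K * \<delta>")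
      case True
      then show ?thesis using base Suc.prems by blast
    next
      case False
      let ?T = "{p \<in> region c Q \<delta> \<eta>. c * \<eta> * \<delta> / 2 < \<bar>dep3 p\<bar>}"
      have h: "0 < \<eta> / 2" "\<eta> / 2 \<le> 1" using Suc.prems by auto
      have e: "Q * (\<eta> / 2)\<^sup>2 = Q * \<eta>\<^sup>2 / 4" by (simp add: power_divide)
      have d: "\<delta> \<le> 8192 * c * \<delta>" using c Suc.prems mult_right_mono[of 1 "8192 * c" \<delta>] by simp
      have big: "8192 * c * \<delta> \<le> Q * \<eta>\<^sup>2 / 4" using False by (simp add: K_def)
      have le: "8192 * c * \<delta> \<le> Q * \<eta>\<^sup>2" using big d Suc.prems by linarith
      have "region c Q \<delta> \<eta> \<subseteq> ?T \<union> region c Q \<delta> (\<eta> / 2)" by (auto simp: region_def)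
      moreover have "finite (?T \<union> region c Q \<delta> (\<eta> / 2))"
        by (simp add: finite_region finite_subset[OF _ finite_region])
      ultimately have "card (region c Q \<delta> \<eta>) \<le> card (?T \<union> region c Q \<delta> (\<eta> / 2))" by (intro card_mono)
      also have "\<dots> \<le> card ?T + card (region c Q \<delta> (\<eta> / 2))" by (rule card_Un_le)
      finally have "real (card (region c Q \<delta> \<eta>)) \<le> real (card ?T) + real (card (region c Q \<delta> (\<eta> / 2)))" by linarith
      also have "real (card ?T) \<le> B * (Q\<^sup>2 * \<delta>\<^sup>2 * \<eta>)"
        unfolding B_def by (rule region_count_top[OF c Suc.prems(1-3) le])
      also have "real (card (region c Q \<delta> (\<eta> / 2))) \<le> (2 * (A + B)) * (Q\<^sup>2 * \<delta>\<^sup>2 * (\<eta> / 2))"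
        by (rule Suc.IH[OF Suc.prems(1) h]) (use Suc.prems(5) d big in \<open>auto simp: e\<close>)
      also have "B * (Q\<^sup>2 * \<delta>\<^sup>2 * \<eta>) + (2 * (A + B)) * (Q\<^sup>2 * \<delta>\<^sup>2 * (\<eta> / 2)) = (A + 2 * B) * (Q\<^sup>2 * \<delta>\<^sup>2 * \<eta>)"
        by (simp add: algebra_simps)
      also have "\<dots> \<le> (2 * (A + B)) * (Q\<^sup>2 * \<delta>\<^sup>2 * \<eta>)" using AB Suc.prems by (intro mult_right_mono) auto
      finally show ?thesis by simp
    qed
  qed
  note bound = this
  have "real (card (region c Q \<delta> \<eta>)) \<le> (2 * (A + B)) * (Q\<^sup>2 * \<delta>\<^sup>2 * \<eta>)"
    if par: "0 < \<delta>" "0 < \<eta>" "\<eta> \<le> 1" "\<delta> \<le> Q * \<eta>\<^sup>2" for Q \<delta> \<eta>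
  proof -
    have "0 < K * \<delta>" using K par by simp
    obtain n where "Q * \<eta>\<^sup>2 / (K * \<delta>) < 4 ^ n" using real_arch_pow[of 4] by auto
    then have "Q * \<eta>\<^sup>2 \<le> 4 ^ n * (K * \<delta>)" using \<open>0 < K * \<delta>\<close> by (simp add: field_simps)
    then show ?thesis by (rule bound[OF par])
  qed
  then show ?thesis using AB by (intro that[of "2 * (A + B)"]) auto
qed

definition curve_nbhd :: "real \<Rightarrow> real \<Rightarrow> real \<Rightarrow> cubic set" where
  "curve_nbhd c Q \<delta> = {p. 1 \<le> fst p \<and> of_int (fst p) \<le> Q \<and> \<bar>slope p\<bar> \<le> c \<and>
     \<bar>dep2 p\<bar> \<le> c * \<delta> \<and> \<bar>dep3 p\<bar> \<le> c * \<delta> \<and> discr p \<noteq> 0}"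

text \<open>The intervals \<open>(Q / 2\<^sup>i\<^sup>+\<^sup>1, Q / 2\<^sup>i]\<close> for the leading coefficient contribute
  \<open>O(Q\<^sup>2 \<delta>\<^sup>2 4\<^sup>-\<^sup>i)\<close> each; they stop once \<open>Q / 2\<^sup>i < 1\<close>, where no point is left.\<close>

lemma dyadic_region_count:
  assumes c: "1 \<le> c"
  obtains C :: real where "0 < C" "\<And>Q \<delta> :: real. 0 < \<delta> \<Longrightarrow> \<delta> \<le> 1 \<Longrightarrow>
    finite (curve_nbhd c Q \<delta>) \<and> real (card (curve_nbhd c Q \<delta>)) \<le> C * (Q\<^sup>2 * \<delta>\<^sup>2)"
proof -
  obtain C :: real where C: "0 < C" "\<And>Q \<delta> \<eta> :: real. 0 < \<delta> \<Longrightarrow> 0 < \<eta> \<Longrightarrow> \<eta> \<le> 1 \<Longrightarrow> \<delta> \<le> Q * \<eta>\<^sup>2 \<Longrightarrow>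
    real (card (region c Q \<delta> \<eta>)) \<le> C * (Q\<^sup>2 * \<delta>\<^sup>2 * \<eta>)" using region_count[OF c] by metis
  have small: "finite (curve_nbhd c Q \<delta>) \<and> real (card (curve_nbhd c Q \<delta>)) \<le> 2 * C * (Q\<^sup>2 * \<delta>\<^sup>2)" if "Q < 1" for Q \<delta>
  proof -
    have "curve_nbhd c Q \<delta> = {}"
    proof (rule equals0I)
      fix p assume "p \<in> curve_nbhd c Q \<delta>"
      then have "1 \<le> real_of_int (fst p)" "real_of_int (fst p) \<le> Q" by (simp_all add: curve_nbhd_def)
      with \<open>Q < 1\<close> show False by linarith
    qed
    then show ?thesis using C(1) by simp
  qed
  have main: "finite (curve_nbhd c Q \<delta>) \<and> real (card (curve_nbhd c Q \<delta>)) \<le> 2 * C * (Q\<^sup>2 * \<delta>\<^sup>2)"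
    if "0 < \<delta>" "\<delta> \<le> 1" "Q < 2 ^ n" for Q \<delta> n
    using that
  proof (induction n arbitrary: Q)
    case 0
    then show ?case using small by simp
  next
    case (Suc n)
    show ?case
    proof (cases "Q < 1")
      case False
      have IH: "finite (curve_nbhd c (Q / 2) \<delta>)" "real (card (curve_nbhd c (Q / 2) \<delta>)) \<le> 2 * C * ((Q / 2)\<^sup>2 * \<delta>\<^sup>2)"
        using Suc.IH[of "Q / 2"] Suc.prems by auto
      have sub: "curve_nbhd c Q \<delta> \<subseteq> region c Q \<delta> 1 \<union> curve_nbhd c (Q / 2) \<delta>" by (auto simp: curve_nbhd_def region_def)
      have fin: "finite (region c Q \<delta> 1 \<union> curve_nbhd c (Q / 2) \<delta>)" using IH finite_region by blast
      have "card (curve_nbhd c Q \<delta>) \<le> card (region c Q \<delta> 1 \<union> curve_nbhd c (Q / 2) \<delta>)" by (rule card_mono[OF fin sub])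
      also have "\<dots> \<le> card (region c Q \<delta> 1) + card (curve_nbhd c (Q / 2) \<delta>)" by (rule card_Un_le)
      finally have "real (card (curve_nbhd c Q \<delta>)) \<le> real (card (region c Q \<delta> 1)) + real (card (curve_nbhd c (Q / 2) \<delta>))"
        by linarith
      also have "real (card (region c Q \<delta> 1)) \<le> C * (Q\<^sup>2 * \<delta>\<^sup>2)"
        using C(2)[of \<delta> 1 Q] False Suc.prems by simp
      also have "C * (Q\<^sup>2 * \<delta>\<^sup>2) + real (card (curve_nbhd c (Q / 2) \<delta>)) \<le> C * (Q\<^sup>2 * \<delta>\<^sup>2) + 1 / 2 * (C * (Q\<^sup>2 * \<delta>\<^sup>2))"
        using IH(2) by (simp add: power_divide)
      also have "\<dots> \<le> 2 * C * (Q\<^sup>2 * \<delta>\<^sup>2)"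
        using mult_nonneg_nonneg[of C "Q\<^sup>2 * \<delta>\<^sup>2"] C(1) by simp
      finally show ?thesis using finite_subset[OF sub fin] by simp
    qed (rule small)
  qed
  show ?thesis
  proof (rule that[of "2 * C"])
    show "0 < 2 * C" using C by simp
    fix Q \<delta> :: real assume d: "0 < \<delta>" "\<delta> \<le> 1"
    obtain n where "Q < 2 ^ n" using real_arch_pow[of 2 Q] by auto
    from main[OF d this] show "finite (curve_nbhd c Q \<delta>) \<and>
      real (card (curve_nbhd c Q \<delta>)) \<le> 2 * C * (Q\<^sup>2 * \<delta>\<^sup>2)" .
  qed
qed

text \<open>Near \<open>(1, x, x\<^sup>2, x\<^sup>3)\<close> the slope satisfies \<open>p0 \<bar>x - \<xi>\<bar> \<le> d\<close>, and replacing \<open>x\<close> by \<open>\<xi>\<close> in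
  \<open>p0 x\<^sup>2\<close> and \<open>p0 x\<^sup>3\<close> costs multiples of \<open>p0 (x - \<xi>)\<close> with bounded cofactors.\<close>

lemma near_curve_depressed:
  fixes x d b :: real
  assumes p0: "1 \<le> p0" and x: "\<bar>x\<bar> \<le> b" and d: "0 < d" "d \<le> 1"
    and near: "\<bar>of_int p0 * x - of_int p1\<bar> \<le> d" "\<bar>of_int p0 * x\<^sup>2 - of_int p2\<bar> \<le> d"
      "\<bar>of_int p0 * x ^ 3 - of_int p3\<bar> \<le> d"
  defines "c \<equiv> 1 + 3 * (b + 1) + 5 * (b + 1)\<^sup>2"
  shows "\<bar>slope (p0, p1, p2, p3)\<bar> \<le> c" "\<bar>dep2 (p0, p1, p2, p3)\<bar> \<le> c * d"
    "\<bar>dep3 (p0, p1, p2, p3)\<bar> \<le> c * d"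
proof -
  define B where "B = b + 1"
  define \<xi> where "\<xi> = slope (p0, p1, p2, p3)"
  have q: "1 \<le> real_of_int p0" using p0 by simp
  have B: "1 \<le> B" using x by (simp add: B_def)
  have p1: "real_of_int p1 = of_int p0 * \<xi>" using q by (simp add: \<xi>_def slope_def)
  have dx: "of_int p0 * \<bar>x - \<xi>\<bar> \<le> d"
  proof -
    have "\<bar>of_int p0 * (x - \<xi>)\<bar> \<le> d" using near(1) by (simp add: p1 right_diff_distrib)
    then show ?thesis using q by (simp add: abs_mult)
  qed
  have "\<bar>x - \<xi>\<bar> \<le> of_int p0 * \<bar>x - \<xi>\<bar>" using mult_right_mono[OF q, of "\<bar>x - \<xi>\<bar>"] by simp
  also have "\<dots> \<le> 1" by (rule order_trans[OF dx d(2)])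
  finally have "\<bar>x - \<xi>\<bar> \<le> 1" .
  then have \<xi>: "\<bar>\<xi>\<bar> \<le> B" using x by (simp add: B_def)
  have xB: "\<bar>x\<bar> \<le> B" using x by (simp add: B_def)
  have BB: "0 \<le> B\<^sup>2" by simp
  have c: "c = 1 + 3 * B + 5 * B\<^sup>2" by (simp add: c_def B_def)
  have key: "\<bar>of_int p0 * (x - \<xi>) * z\<bar> \<le> d * w" if "\<bar>z\<bar> \<le> w" for z w
  proof -
    have "(of_int p0 * \<bar>x - \<xi>\<bar>) * \<bar>z\<bar> \<le> d * w" by (intro mult_mono dx that) (use d in auto)
    then show ?thesis using q by (simp add: abs_mult)
  qed
  show "\<bar>slope (p0, p1, p2, p3)\<bar> \<le> c" using \<xi> B BB unfolding c \<xi>_def[symmetric] by linarith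
  have "dep2 (p0, p1, p2, p3) = - (of_int p0 * x\<^sup>2 - of_int p2) + of_int p0 * (x - \<xi>) * (x + \<xi>)"
    by (simp add: dep2_def \<xi>_def[symmetric] power2_eq_square algebra_simps)
  also have "\<bar>\<dots>\<bar> \<le> d + d * (2 * B)" using near(2) key[of "x + \<xi>" "2 * B"] xB \<xi> by linarith
  also have "\<dots> = (1 + 2 * B) * d" by (simp add: algebra_simps)
  also have "\<dots> \<le> c * d" using B BB d unfolding c by (intro mult_right_mono) auto
  finally show "\<bar>dep2 (p0, p1, p2, p3)\<bar> \<le> c * d" .
  have sq: "\<bar>y * z\<bar> \<le> B\<^sup>2" if "\<bar>y\<bar> \<le> B" "\<bar>z\<bar> \<le> B" for y z
    using mult_mono[OF that] that B by (simp add: abs_mult power2_eq_square)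
  have w: "\<bar>x * x - 2 * (\<xi> * x) - 2 * (\<xi> * \<xi>)\<bar> \<le> 5 * B\<^sup>2"
    using sq[OF xB xB] sq[OF \<xi> xB] sq[OF \<xi> \<xi>] by linarith
  have v: "\<bar>3 * \<xi> * (of_int p0 * x\<^sup>2 - of_int p2)\<bar> \<le> 3 * B * d"
    unfolding abs_mult using \<xi> near(2) B d by (intro mult_mono) auto
  have "dep3 (p0, p1, p2, p3) = - (of_int p0 * x ^ 3 - of_int p3) + 3 * \<xi> * (of_int p0 * x\<^sup>2 - of_int p2)
      + of_int p0 * (x - \<xi>) * (x * x - 2 * (\<xi> * x) - 2 * (\<xi> * \<xi>))"
    by (simp add: dep3_def \<xi>_def[symmetric] power2_eq_square power3_eq_cube algebra_simps)
  also have "\<bar>\<dots>\<bar> \<le> d + 3 * B * d + d * (5 * B\<^sup>2)" using near(3) v key[OF w] by linarith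
  also have "\<dots> = c * d" unfolding c by (simp add: algebra_simps)
  finally show "\<bar>dep3 (p0, p1, p2, p3)\<bar> \<le> c * d" .
qed

theorem theorem2:
  fixes a b :: real
  assumes "a \<le> b"
  shows "\<exists>C>0. \<forall>Q \<delta> :: real. 2 \<le> Q \<longrightarrow> 0 < \<delta> \<longrightarrow> \<delta> < 1 / 2 \<longrightarrow>
           finite (generic_points {a..b} Q \<delta>) \<and>
           real (N_g {a..b} Q \<delta>) \<le> C * Q\<^sup>2 * \<delta>\<^sup>2"
proof -
  define B where "B = max \<bar>a\<bar> \<bar>b\<bar>"
  define c where "c = 1 + 3 * (B + 1) + 5 * (B + 1)\<^sup>2"
  have c: "1 \<le> c" by (simp add: c_def B_def)
  obtain C :: real where C: "0 < C" "\<And>Q d :: real. 0 < d \<Longrightarrow> d \<le> 1 \<Longrightarrow>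
      finite (curve_nbhd c Q d) \<and> real (card (curve_nbhd c Q d)) \<le> C * (Q\<^sup>2 * d\<^sup>2)"
    using dyadic_region_count[OF c] by blast
  have sub: "generic_points {a..b} Q \<delta> \<subseteq> curve_nbhd c Q (2 * \<delta>)" if \<delta>: "0 < \<delta>" "\<delta> < 1 / 2" for Q \<delta>
  proof (rule subsetI)
    fix p assume p: "p \<in> generic_points {a..b} Q \<delta>"
    obtain p0 p1 p2 p3 where pp: "p = (p0, p1, p2, p3)" by (cases p)
    let ?f = "\<lambda>(x1, x2, x3). Max {\<bar>real_of_int p0 * x1 - of_int p1\<bar>, \<bar>of_int p0 * x2 - of_int p2\<bar>,
             \<bar>of_int p0 * x3 - of_int p3\<bar>}"
    have g: "\<not> special (p0, p1, p2, p3)" "1 \<le> p0" "of_int p0 \<le> Q"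
      "(INF x \<in> veronese3 {a..b}. ?f x) \<le> \<delta>"
      using p by (auto simp: generic_points_def pp)
    have "(INF x \<in> veronese3 {a..b}. ?f x) < 2 * \<delta>" using g(4) \<delta> by linarith
    moreover have "bdd_below (?f ` veronese3 {a..b})"
      by (rule bdd_belowI[of _ 0]) (auto simp: le_max_iff_disj)
    moreover have "veronese3 {a..b} \<noteq> {}" using assms by (simp add: veronese3_def)
    ultimately obtain y where "y \<in> veronese3 {a..b}" "?f y < 2 * \<delta>"
      by (metis (no_types, lifting) cINF_less_iff)
    then obtain x where x: "x \<in> {a..b}" "?f (x, x\<^sup>2, x ^ 3) < 2 * \<delta>" by (auto simp: veronese3_def)
    have near: "\<bar>of_int p0 * x - of_int p1\<bar> \<le> 2 * \<delta>" "\<bar>of_int p0 * x\<^sup>2 - of_int p2\<bar> \<le> 2 * \<delta>"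
      "\<bar>of_int p0 * x ^ 3 - of_int p3\<bar> \<le> 2 * \<delta>" using x(2) by auto
    have xB: "\<bar>x\<bar> \<le> B" using x(1) by (auto simp: B_def)
    have "discr (p0, p1, p2, p3) \<noteq> 0" using special_if_discr_zero g(1,2) by blast
    then show "p \<in> curve_nbhd c Q (2 * \<delta>)"
      using near_curve_depressed[OF g(2) xB _ _ near, folded c_def] g(2,3) \<delta> by (simp add: curve_nbhd_def pp)
  qed
  show ?thesis
  proof (intro exI[of _ "4 * C"] conjI allI impI)
    show "0 < 4 * C" using C by simp
    fix Q \<delta> :: real assume "2 \<le> Q" and \<delta>: "0 < \<delta>" "\<delta> < 1 / 2"
    have W: "finite (curve_nbhd c Q (2 * \<delta>))" "real (card (curve_nbhd c Q (2 * \<delta>))) \<le> C * (Q\<^sup>2 * (2 * \<delta>)\<^sup>2)"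
      using C(2)[of "2 * \<delta>" Q] \<delta> by auto
    show "finite (generic_points {a..b} Q \<delta>)" by (rule finite_subset[OF sub[OF \<delta>] W(1)])
    have "real (N_g {a..b} Q \<delta>) \<le> real (card (curve_nbhd c Q (2 * \<delta>)))"
      unfolding N_g_def using card_mono[OF W(1) sub[OF \<delta>]] by simp
    also have "\<dots> \<le> 4 * C * Q\<^sup>2 * \<delta>\<^sup>2" using W(2) by (simp add: power_mult_distrib)
    finally show "real (N_g {a..b} Q \<delta>) \<le> 4 * C * Q\<^sup>2 * \<delta>\<^sup>2" .
  qed
qed

end
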